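(* (a) There are infinite sets $A, B \subseteq \omega$ and a single relative c.e. operator $\Theta$ such that $\Theta(S) = A$ for every infinite $S \subseteq B$, but there is no infinite $C \subseteq B$ such that every infinite subset of $C$ computes $A$. (b) There are infinite sets $A, B \subseteq \omega$ and a single relative c.e. operator $\Theta$ such that $\Theta(S) = A$ for every infinite $S \subseteq B$, but there is no infinite $C \subseteq A$ such that every infinite subset of $B$ computes $C$.
   Context: A relative c.e. operator is a c.e. set $\Theta$ of pairs $(\sigma, x) \in 2^{<\omega}\times\omega$; for $X \subseteq \omega$ (identified with its characteristic function), $\Theta(X)$ is the set of $x$ for which there is $\sigma$ an initial segment of $X$ with $(\sigma,x) \in \Theta$. Thus $\Theta(S) = A$ for all infinite $S\subseteq B$ means that $A$ is c.e. in every infinite subset of $B$ via one fixed enumeration procedure. *)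

theory Defs
  imports Main "HOL-Library.Nat_Bijection"
begin

text \<open>Total (general) recursive functions relative to an oracle X, in the
  standard Kleene style: basic functions, the oracle's characteristic function,
  composition, primitive recursion, and regular minimisation.
  A function of arity n is represented as nat list => nat; only its values
  on lists of length n are meaningful.\<close>

inductive rec_in :: "nat set \<Rightarrow> nat \<Rightarrow> (nat list \<Rightarrow> nat) \<Rightarrow> bool" for X :: "nat set" where
  r_zero: "rec_in X n (\<lambda>_. 0)"
| r_succ: "rec_in X 1 (\<lambda>xs. Suc (hd xs))"
| r_proj: "i < n \<Longrightarrow> rec_in X n (\<lambda>xs. xs ! i)"
| r_oracle: "rec_in X 1 (\<lambda>xs. if hd xs \<in> X then 1 else 0)"
| r_comp: "rec_in X k g \<Longrightarrow> length fs = k \<Longrightarrow> (\<forall>i<k. rec_in X n (fs ! i))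
            \<Longrightarrow> rec_in X n (\<lambda>xs. g (map (\<lambda>f. f xs) fs))"
| r_prim: "rec_in X n g \<Longrightarrow> rec_in X (n + 2) h
            \<Longrightarrow> rec_in X (Suc n) (\<lambda>xs. rec_nat (g (tl xs)) (\<lambda>y r. h (y # r # tl xs)) (hd xs))"
| r_mu: "rec_in X (Suc n) g \<Longrightarrow> (\<forall>xs. length xs = n \<longrightarrow> (\<exists>y. g (y # xs) = 0))
            \<Longrightarrow> rec_in X n (\<lambda>xs. LEAST y. g (y # xs) = 0)"

definition turing_le :: "nat set \<Rightarrow> nat set \<Rightarrow> bool" where
  "turing_le A X \<longleftrightarrow> (\<exists>f. rec_in X 1 f \<and> (\<forall>x. f [x] = (if x \<in> A then 1 else 0)))"

definition ce :: "nat set \<Rightarrow> bool" where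
  "ce W \<longleftrightarrow> (\<exists>f. rec_in {} 2 f \<and> (\<forall>x. x \<in> W \<longleftrightarrow> (\<exists>y. f [x, y] = 0)))"

text \<open>Standard bijective coding of binary strings by natural numbers.\<close>
fun str_code :: "bool list \<Rightarrow> nat" where
  "str_code [] = 0"
| "str_code (b # bs) = 2 * str_code bs + (if b then 2 else 1)"

definition init_seg :: "bool list \<Rightarrow> nat set \<Rightarrow> bool" where
  "init_seg \<sigma> X \<longleftrightarrow> (\<forall>i < length \<sigma>. \<sigma> ! i = (i \<in> X))"

definition ce_operator :: "(bool list \<times> nat) set \<Rightarrow> bool" where
  "ce_operator \<Theta> \<longleftrightarrow> ce ((\<lambda>(\<sigma>, x). prod_encode (str_code \<sigma>, x)) ` \<Theta>)"

definition op_apply :: "(bool list \<times> nat) set \<Rightarrow> nat set \<Rightarrow> nat set" where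
  "op_apply \<Theta> X = {x. \<exists>\<sigma>. init_seg \<sigma> X \<and> (\<sigma>, x) \<in> \<Theta>}"

end

theory Submission
  imports Defs Complex_Main "HOL-Library.Countable" "HOL-Library.Infinite_Set"
begin

text \<open>One operator serves for both parts: each element of the oracle set is read as a finite table
  telling what may be enumerated from which finite part of the oracle. Hence for any family of open
  sets \<open>U n\<close> there is an infinite \<open>Q\<close> all of whose infinite subsets \<open>S\<close> enumerate \<open>{n. S \<in> U n}\<close>.

  (a) Let \<open>n\<close> name a pair of a functional \<open>\<Phi>\<^sub>e\<close> and a finite set \<open>t\<close>, and let \<open>U n\<close> say that
  \<open>\<Phi>\<^sub>e(t \<union> S'; n) = 0\<close> for the set \<open>S'\<close> obtained by deleting the first \<open>n\<close> elements of \<open>S\<close>. By the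
  Ramsey property of open sets and a fusion argument there is \<open>B \<subseteq> Q\<close> all of whose infinite subsets
  agree on every \<open>U n\<close>, so they enumerate the same set \<open>A\<close>. Every infinite \<open>C \<subseteq> B\<close> has an infinite
  subset \<open>D\<close> so sparse that, for each \<open>e\<close>, the functional \<open>\<Phi>\<^sub>e(D)\<close> errs about membership in \<open>A\<close> at
  the name of \<open>e\<close> and the first \<open>e\<close> elements of \<open>D\<close>.

  (b) Here \<open>B\<close> is the union of two sets of codes of finite subsets of \<open>A\<close> converging to \<open>A\<close>. They are
  built together with \<open>A\<close> by finite extensions such that no infinite \<open>C \<subseteq> A\<close> is computable from
  both.\<close>

section \<open>Oracle computations and their use\<close>

text \<open>\<open>rec_in\<close> ties a total function to one oracle. Diagonalisation needs
  countably many syntactic indices that can be run on any other oracle, where they may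
  diverge.\<close>

datatype prog = Zero | Succ | Proj nat | Query | Comp prog "prog list" | Prim prog prog | Mu prog

instance prog :: countable
  by countable_datatype

inductive ev :: "nat set \<Rightarrow> prog \<Rightarrow> nat list \<Rightarrow> nat \<Rightarrow> bool" for X :: "nat set" where
  ev_Zero: "ev X Zero xs 0"
| ev_Succ: "ev X Succ xs (Suc (hd xs))"
| ev_Proj: "ev X (Proj i) xs (xs ! i)"
| ev_Query: "ev X Query xs (if hd xs \<in> X then 1 else 0)"
| ev_Comp: "length vs = length ps \<Longrightarrow> (\<forall>i<length ps. ev X (ps ! i) xs (vs ! i))
    \<Longrightarrow> ev X g vs v \<Longrightarrow> ev X (Comp g ps) xs v"
| ev_Prim0: "ev X g xs v \<Longrightarrow> ev X (Prim g h) (0 # xs) v"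
| ev_PrimS: "ev X (Prim g h) (y # xs) r \<Longrightarrow> ev X h (y # r # xs) v
    \<Longrightarrow> ev X (Prim g h) (Suc y # xs) v"
| ev_Mu: "ev X g (v # xs) 0 \<Longrightarrow> (\<forall>y<v. \<exists>w. ev X g (y # xs) (Suc w)) \<Longrightarrow> ev X (Mu g) xs v"

inductive_cases ev_ZeroE: "ev X Zero xs v"
inductive_cases ev_SuccE: "ev X Succ xs v"
inductive_cases ev_ProjE: "ev X (Proj i) xs v"
inductive_cases ev_QueryE: "ev X Query xs v"
inductive_cases ev_CompE: "ev X (Comp g ps) xs v"
inductive_cases ev_Prim0E: "ev X (Prim g h) (0 # xs) v"
inductive_cases ev_PrimSE: "ev X (Prim g h) (Suc y # xs) v"
inductive_cases ev_MuE: "ev X (Mu g) xs v"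

lemma ev_unique: "ev X p xs v \<Longrightarrow> ev X p xs w \<Longrightarrow> v = w"
proof (induction arbitrary: w rule: ev.induct)
  case (ev_Comp vs ps xs g v)
  from ev_Comp.prems obtain vs' where vs': "length vs' = length ps"
    "\<forall>i<length ps. ev X (ps ! i) xs (vs' ! i)" "ev X g vs' w"
    by (rule ev_CompE)
  have "vs = vs'"
    using ev_Comp.hyps(1) ev_Comp.IH(1) vs'(1,2) by (intro nth_equalityI) auto
  then show ?case
    using ev_Comp.IH(2) vs'(3) by blast
next
  case (ev_PrimS g h y xs r v)
  from ev_PrimS.prems obtain r' where "ev X (Prim g h) (y # xs) r'" "ev X h (y # r' # xs) w"
    by (rule ev_PrimSE)
  then show ?case
    using ev_PrimS.IH by blast
next
  case (ev_Mu g v xs)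
  from ev_Mu.prems have w: "ev X g (w # xs) 0" "\<forall>y<w. \<exists>z. ev X g (y # xs) (Suc z)"
    by (auto elim: ev_MuE)
  have "\<not> v < w"
    using ev_Mu.IH(1) w(2) by fastforce
  moreover have "\<not> w < v"
    using ev_Mu.IH(2) w(1) by fastforce
  ultimately show ?case by simp
next
  case (ev_Prim0 g xs v h)
  then show ?case by (blast elim: ev_Prim0E)
qed (erule ev_ZeroE ev_SuccE ev_ProjE ev_QueryE, simp)+

text \<open>The use principle: a derivation queries finitely many numbers. Stating the bound as
  \<open>eventually\<close> lets the bounds of finitely many subderivations be combined without
  explicit maxima.\<close>

lemma ev_use_eventually:
  "ev X p xs v \<Longrightarrow>
    \<forall>\<^sub>F u in sequentially. \<forall>Y. Y \<inter> {..<u} = X \<inter> {..<u} \<longrightarrow> ev Y p xs v"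
proof (induction rule: ev.induct)
  case (ev_Query xs)
  have "\<forall>Y. Y \<inter> {..<u} = X \<inter> {..<u} \<longrightarrow> ev Y Query xs (if hd xs \<in> X then 1 else 0)"
    if "Suc (hd xs) \<le> u" for u
  proof (intro allI impI)
    fix Y assume "Y \<inter> {..<u} = X \<inter> {..<u}"
    then have "hd xs \<in> Y \<inter> {..<u} \<longleftrightarrow> hd xs \<in> X \<inter> {..<u}" by (rule arg_cong)
    then have "hd xs \<in> Y \<longleftrightarrow> hd xs \<in> X" using that by simp
    then show "ev Y Query xs (if hd xs \<in> X then 1 else 0)"
      using ev.ev_Query[of Y xs] by simp
  qed
  then show ?case unfolding eventually_sequentially by blast
next
  case (ev_Comp vs ps xs g v)
  have "\<forall>\<^sub>F u in sequentially. \<forall>i\<in>{..<length ps}.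
      \<forall>Y. Y \<inter> {..<u} = X \<inter> {..<u} \<longrightarrow> ev Y (ps ! i) xs (vs ! i)"
    using ev_Comp.IH(1) by (intro eventually_ball_finite) auto
  with ev_Comp.IH(2) show ?case
    by eventually_elim (use ev_Comp.hyps(1) in \<open>auto intro!: ev.ev_Comp\<close>)
next
  case (ev_PrimS g h y xs r v)
  from ev_PrimS.IH show ?case
  proof eventually_elim
    case (elim u)
    then show ?case by (meson ev.ev_PrimS)
  qed
next
  case (ev_Mu g v xs)
  \<comment> \<open>The values at arguments below \<open>v\<close> are chosen before the bound
    \<open>u\<close>, so that only finitely many eventual statements have to be intersected.\<close>
  from ev_Mu.IH(2) have "\<forall>y. \<exists>w. y < v \<longrightarrow> (\<forall>\<^sub>F u in sequentially.
      \<forall>Y. Y \<inter> {..<u} = X \<inter> {..<u} \<longrightarrow> ev Y g (y # xs) (Suc w))"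
    by blast
  from choice[OF this] obtain w where w: "\<And>y. y < v \<Longrightarrow> \<forall>\<^sub>F u in sequentially.
      \<forall>Y. Y \<inter> {..<u} = X \<inter> {..<u} \<longrightarrow> ev Y g (y # xs) (Suc (w y))"
    by blast
  have "\<forall>\<^sub>F u in sequentially. \<forall>y\<in>{..<v}.
      \<forall>Y. Y \<inter> {..<u} = X \<inter> {..<u} \<longrightarrow> ev Y g (y # xs) (Suc (w y))"
    using w by (intro eventually_ball_finite) auto
  with ev_Mu.IH(1) show ?case
  proof eventually_elim
    case (elim u)
    then show ?case by (meson ev.ev_Mu lessThan_iff)
  qed
next
  case (ev_Prim0 g xs v h)
  from ev_Prim0.IH show ?case
    by eventually_elim (blast intro: ev.ev_Prim0)
qed (simp_all add: ev.ev_Zero ev.ev_Succ ev.ev_Proj)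

text \<open>Turns a reduction into an index. \<open>Mu\<close> terminates because minimisation is
  regular: a least zero exists and all earlier values are positive.\<close>

lemma rec_in_imp_ev:
  "rec_in X n f \<Longrightarrow> \<exists>p. \<forall>xs. length xs = n \<longrightarrow> ev X p xs (f xs)"
proof (induction rule: rec_in.induct)
  case (r_zero n)
  show ?case by (intro exI[of _ Zero]) (auto intro: ev.intros)
next
  case r_succ
  show ?case by (intro exI[of _ Succ]) (auto intro: ev.intros)
next
  case (r_proj i n)
  show ?case by (intro exI[of _ "Proj i"]) (auto intro: ev.intros)
next
  case r_oracle
  show ?case using ev_Query by blast
next
  case (r_comp k g fs n)
  from r_comp.IH(1) obtain q where q: "\<forall>xs. length xs = k \<longrightarrow> ev X q xs (g xs)" by blast
  from r_comp.IH(2) obtain p where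
    p: "\<forall>i<k. \<forall>xs. length xs = n \<longrightarrow> ev X (p i) xs ((fs ! i) xs)" by metis
  have "ev X (Comp q (map p [0..<k])) xs (g (map (\<lambda>f. f xs) fs))" if "length xs = n" for xs
    by (rule ev_Comp[where vs = "map (\<lambda>f. f xs) fs"]) (use that p q r_comp.hyps(2) in auto)
  then show ?case by blast
next
  case (r_prim n g h)
  from r_prim.IH obtain p q where
    p: "\<forall>xs. length xs = n \<longrightarrow> ev X p xs (g xs)" and
    q: "\<forall>xs. length xs = n + 2 \<longrightarrow> ev X q xs (h xs)" by blast
  have *: "ev X (Prim p q) (y # xs) (rec_nat (g xs) (\<lambda>y r. h (y # r # xs)) y)"
    if "length xs = n" for y xs
  proof (induction y)
    case 0
    then show ?case using p that by (simp add: ev_Prim0)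
  next
    case (Suc y)
    then show ?case using q that by (auto intro: ev_PrimS)
  qed
  have "ev X (Prim p q) xs (rec_nat (g (tl xs)) (\<lambda>y r. h (y # r # tl xs)) (hd xs))"
    if "length xs = Suc n" for xs
    using *[of "tl xs" "hd xs"] that by (cases xs) auto
  then show ?case by blast
next
  case (r_mu n g)
  from r_mu.IH obtain p where p: "\<forall>xs. length xs = Suc n \<longrightarrow> ev X p xs (g xs)" by blast
  have "ev X (Mu p) xs (LEAST y. g (y # xs) = 0)" if len: "length xs = n" for xs
  proof (rule ev_Mu)
    have "\<exists>y. g (y # xs) = 0" using r_mu.hyps(2) len by simp
    then have "g ((LEAST y. g (y # xs) = 0) # xs) = 0" by (rule LeastI_ex)
    then show "ev X p ((LEAST y. g (y # xs) = 0) # xs) 0"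
      using p[rule_format, of "(LEAST y. g (y # xs) = 0) # xs"] len by simp
    show "\<forall>y<LEAST y. g (y # xs) = 0. \<exists>w. ev X p (y # xs) (Suc w)"
    proof (intro allI impI)
      fix y assume "y < (LEAST y. g (y # xs) = 0)"
      then have "g (y # xs) \<noteq> 0" by (rule not_less_Least)
      then show "\<exists>w. ev X p (y # xs) (Suc w)"
        using p[rule_format, of "y # xs"] len by (cases "g (y # xs)") auto
    qed
  qed
  then show ?case by blast
qed

text \<open>The graph of the e-th partial functional: Phi_e(X; n) = v.\<close>

definition phi :: "nat \<Rightarrow> nat set \<Rightarrow> nat \<Rightarrow> nat \<Rightarrow> bool" where
  "phi e X n v \<longleftrightarrow> ev X (from_nat e) [n] v"

lemma phi_unique: "phi e X n v \<Longrightarrow> phi e X n w \<Longrightarrow> v = w"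
  unfolding phi_def by (rule ev_unique)

lemma phi_use:
  assumes "phi e X n v"
  obtains u where "\<And>u' Y. u \<le> u' \<Longrightarrow> Y \<inter> {..<u'} = X \<inter> {..<u'} \<Longrightarrow> phi e Y n v"
proof -
  from ev_use_eventually[OF assms[unfolded phi_def]] obtain u where
    u: "\<forall>u'\<ge>u. \<forall>Y. Y \<inter> {..<u'} = X \<inter> {..<u'} \<longrightarrow> ev Y (from_nat e) [n] v"
    unfolding eventually_sequentially ..
  show thesis
  proof (rule that)
    fix u' Y assume "u \<le> u'" "Y \<inter> {..<u'} = X \<inter> {..<u'}"
    with u[rule_format] show "phi e Y n v" unfolding phi_def .
  qed
qed

lemma turing_le_phi:
  assumes "turing_le A X"
  obtains e where "\<And>n. phi e X n (of_bool (n \<in> A))"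
proof -
  from assms obtain f where f: "rec_in X 1 f" "\<forall>x. f [x] = (if x \<in> A then 1 else 0)"
    unfolding turing_le_def by blast
  from rec_in_imp_ev[OF f(1)] obtain p where "\<forall>xs. length xs = 1 \<longrightarrow> ev X p xs (f xs)" ..
  then have "ev X p [n] (of_bool (n \<in> A))" for n
    using f(2) by (auto simp: of_bool_def dest!: spec[of _ "[n]"])
  then have "phi (to_nat p) X n (of_bool (n \<in> A))" for n
    by (simp add: phi_def)
  with that show thesis by blast
qed

lemma phi_const_zero: "phi (to_nat Zero) X n 0"
  by (simp add: phi_def ev_Zero)

section \<open>Recursive functions and decidable predicates\<close>

text \<open>\<open>rec_in\<close> also fixes values on lists of the wrong length;
  \<open>recf\<close> disregards them, so that functions can be rewritten by equations valid at
  length \<open>n\<close>.\<close>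

definition recf :: "nat \<Rightarrow> (nat list \<Rightarrow> nat) \<Rightarrow> bool" where
  "recf n f \<longleftrightarrow> (\<exists>g. rec_in {} n g \<and> (\<forall>xs. length xs = n \<longrightarrow> g xs = f xs))"

lemma recf_cong: "recf n f \<Longrightarrow> (\<And>xs. length xs = n \<Longrightarrow> f xs = g xs) \<Longrightarrow> recf n g"
  unfolding recf_def by auto

lemma recf_comp:
  assumes "recf k g" "length fs = k" "\<And>f. f \<in> set fs \<Longrightarrow> recf n f"
  shows "recf n (\<lambda>xs. g (map (\<lambda>f. f xs) fs))"
proof -
  from assms(1) obtain g' where g': "rec_in {} k g'" "\<And>xs. length xs = k \<Longrightarrow> g' xs = g xs"
    unfolding recf_def by blast
  from assms(3) obtain F where
    F: "\<And>f. f \<in> set fs \<Longrightarrow> rec_in {} n (F f) \<and> (\<forall>xs. length xs = n \<longrightarrow> F f xs = f xs)"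
    unfolding recf_def by metis
  have "rec_in {} n (\<lambda>xs. g' (map (\<lambda>f. f xs) (map F fs)))"
    by (rule r_comp[OF g'(1)]) (use assms(2) F in auto)
  moreover have "g' (map (\<lambda>f. f xs) (map F fs)) = g (map (\<lambda>f. f xs) fs)"
    if "length xs = n" for xs
  proof -
    have "map (\<lambda>f. f xs) (map F fs) = map (\<lambda>f. f xs) fs"
      using F that by simp
    then show ?thesis using g'(2) assms(2) by (metis length_map)
  qed
  ultimately show ?thesis unfolding recf_def by blast
qed

lemma recf_prim:
  assumes "recf n g" "recf (n + 2) h"
  shows "recf (Suc n) (\<lambda>xs. rec_nat (g (tl xs)) (\<lambda>y r. h (y # r # tl xs)) (hd xs))"
proof -
  from assms obtain g' h' where gh: "rec_in {} n g'" "rec_in {} (n + 2) h'"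
    and eq: "\<And>xs. length xs = n \<Longrightarrow> g' xs = g xs" "\<And>xs. length xs = n + 2 \<Longrightarrow> h' xs = h xs"
    unfolding recf_def by blast
  have "rec_nat (g' (tl xs)) (\<lambda>y r. h' (y # r # tl xs)) k = rec_nat (g (tl xs)) (\<lambda>y r. h (y # r # tl xs)) k"
    if "length xs = Suc n" for xs k
    by (induction k) (use that eq in auto)
  with r_prim[OF gh] show ?thesis unfolding recf_def by blast
qed

lemma recf_nth: "i < n \<Longrightarrow> recf n (\<lambda>xs. xs ! i)"
  unfolding recf_def using r_proj by blast

lemma recf_Suc: "recf n f \<Longrightarrow> recf n (\<lambda>xs. Suc (f xs))"
  using recf_comp[of 1 "\<lambda>xs. Suc (hd xs)" "[f]" n] r_succ[of "{}"]
  by (auto simp: recf_def)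

lemma recf_const: "recf n (\<lambda>_. c)"
proof (induction c)
  case 0
  show ?case unfolding recf_def using r_zero by blast
qed (rule recf_Suc)

lemma recf_comp2:
  assumes "recf 2 (\<lambda>xs. g (xs ! 0) (xs ! 1))" "recf n f1" "recf n f2"
  shows "recf n (\<lambda>xs. g (f1 xs) (f2 xs))"
  using recf_comp[OF assms(1), of "[f1, f2]" n] assms(2,3) by auto

text \<open>Primitive recursion on argument 0 with argument 1 as parameter, the common shape of the
  arithmetic functions below.\<close>

lemma recf_iterate:
  assumes "recf 1 (\<lambda>xs. g (xs ! 0))" "recf 3 (\<lambda>xs. h (xs ! 0) (xs ! 1) (xs ! 2))"
  shows "recf 2 (\<lambda>xs. rec_nat (g (xs ! 1)) (\<lambda>y r. h y r (xs ! 1)) (xs ! 0))"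
proof -
  have "recf (Suc 1) (\<lambda>xs. rec_nat (g (tl xs ! 0))
      (\<lambda>y r. h ((y # r # tl xs) ! 0) ((y # r # tl xs) ! 1) ((y # r # tl xs) ! 2)) (hd xs))"
    by (rule recf_prim) (use assms in \<open>simp_all add: numeral_eq_Suc\<close>)
  then show ?thesis
    unfolding Suc_1 by (rule recf_cong) (auto simp: length_Suc_conv numeral_eq_Suc)
qed

lemma recf_add:
  assumes "recf n f" "recf n g"
  shows "recf n (\<lambda>xs. f xs + g xs)"
proof -
  have "rec_nat b (\<lambda>y r. Suc r) a = a + b" for a b by (induction a) auto
  then have "recf 2 (\<lambda>xs. xs ! 0 + xs ! 1)"
    using recf_iterate[of "\<lambda>b. b" "\<lambda>y r b. Suc r"] by (simp add: recf_nth recf_Suc)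
  from recf_comp2[OF this assms] show ?thesis .
qed

lemma recf_mult:
  assumes "recf n f" "recf n g"
  shows "recf n (\<lambda>xs. f xs * g xs)"
proof -
  have "rec_nat 0 (\<lambda>y r. r + b) a = a * b" for a b :: nat by (induction a) auto
  then have "recf 2 (\<lambda>xs. xs ! 0 * xs ! 1)"
    using recf_iterate[of "\<lambda>b. 0" "\<lambda>y r b. r + b"] by (simp add: recf_nth recf_add recf_const)
  from recf_comp2[OF this assms] show ?thesis .
qed

lemma recf_pred:
  assumes "recf n f"
  shows "recf n (\<lambda>xs. f xs - 1)"
proof -
  have "rec_nat 0 (\<lambda>y r. y) a = a - 1" for a :: nat by (induction a) auto
  then have "recf 2 (\<lambda>xs. xs ! 0 - 1)"
    using recf_iterate[of "\<lambda>b. 0" "\<lambda>y r b. y"] by (simp add: recf_nth recf_const)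
  from recf_comp2[OF this assms assms] show ?thesis .
qed

lemma recf_diff:
  assumes "recf n f" "recf n g"
  shows "recf n (\<lambda>xs. f xs - g xs)"
proof -
  \<comment> \<open>The recursion runs on the subtrahend, which is why the arguments are swapped
    back at the end.\<close>
  have "rec_nat b (\<lambda>y r. r - 1) a = b - a" for a b :: nat by (induction a) auto
  then have "recf 2 (\<lambda>xs. xs ! 1 - xs ! 0)"
    using recf_iterate[of "\<lambda>b. b" "\<lambda>y r b. r - 1"]
    by (simp add: recf_nth recf_pred del: One_nat_def)
  from recf_comp2[OF this assms(2,1)] show ?thesis .
qed

lemma recf_pow2:
  assumes "recf n f"
  shows "recf n (\<lambda>xs. 2 ^ f xs)"
proof -
  have "rec_nat 1 (\<lambda>y r. r + r) a = (2 :: nat) ^ a" for a by (induction a) auto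
  then have "recf 2 (\<lambda>xs. 2 ^ (xs ! 0))"
    using recf_iterate[of "\<lambda>b. 1" "\<lambda>y r b. r + r"]
    by (simp add: recf_nth recf_const recf_add del: One_nat_def)
  from recf_comp2[OF this assms assms] show ?thesis .
qed

lemma recf_triangle:
  assumes "recf n f"
  shows "recf n (\<lambda>xs. triangle (f xs))"
proof -
  have "rec_nat 0 (\<lambda>y r. r + Suc y) a = triangle a" for a by (induction a) auto
  then have "recf 2 (\<lambda>xs. triangle (xs ! 0))"
    using recf_iterate[of "\<lambda>b. 0" "\<lambda>y r b. r + Suc y"]
    by (simp add: recf_nth recf_const recf_add recf_Suc del: add_Suc_right)
  from recf_comp2[OF this assms assms] show ?thesis .
qed

lemma recf_prod_encode:
  "recf n f \<Longrightarrow> recf n g \<Longrightarrow> recf n (\<lambda>xs. prod_encode (f xs, g xs))"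
  unfolding prod_encode_def by (simp add: recf_add recf_triangle)

section \<open>Decidable predicates and bounded search\<close>

text \<open>Truth is the value 0, as in \<open>ce\<close>; conjunction then becomes addition and
  disjunction multiplication.\<close>

definition decidable :: "nat \<Rightarrow> (nat list \<Rightarrow> bool) \<Rightarrow> bool" where
  "decidable n P \<longleftrightarrow> (\<exists>g. recf n g \<and> (\<forall>xs. length xs = n \<longrightarrow> (P xs \<longleftrightarrow> g xs = 0)))"

lemma decidable_le: "recf n f \<Longrightarrow> recf n g \<Longrightarrow> decidable n (\<lambda>xs. f xs \<le> g xs)"
  unfolding decidable_def by (intro exI[of _ "\<lambda>xs. f xs - g xs"]) (auto intro: recf_diff)

lemma decidable_conj:
  assumes "decidable n P" "decidable n Q"
  shows "decidable n (\<lambda>xs. P xs \<and> Q xs)"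
proof -
  from assms obtain f g where "recf n f" "\<forall>xs. length xs = n \<longrightarrow> (P xs \<longleftrightarrow> f xs = 0)"
    "recf n g" "\<forall>xs. length xs = n \<longrightarrow> (Q xs \<longleftrightarrow> g xs = 0)"
    unfolding decidable_def by blast
  then show ?thesis
    unfolding decidable_def by (intro exI[of _ "\<lambda>xs. f xs + g xs"]) (auto intro: recf_add)
qed

lemma decidable_less: "recf n f \<Longrightarrow> recf n g \<Longrightarrow> decidable n (\<lambda>xs. f xs < g xs)"
  unfolding Suc_le_eq[symmetric] by (intro decidable_le recf_Suc)

lemma decidable_eq: "recf n f \<Longrightarrow> recf n g \<Longrightarrow> decidable n (\<lambda>xs. f xs = g xs)"
  unfolding eq_iff by (intro decidable_conj decidable_le)

text \<open>The product of the values at 0 up to \<open>b\<close>, computed by primitive recursion,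
  vanishes exactly if some factor does.\<close>

lemma decidable_bex:
  assumes "decidable (Suc n) P" "recf n b"
  shows "decidable n (\<lambda>xs. \<exists>z\<le>b xs. P (z # xs))"
proof -
  from assms(1) obtain g where g: "recf (Suc n) g"
    "\<And>xs. length xs = Suc n \<Longrightarrow> P xs \<longleftrightarrow> g xs = 0"
    unfolding decidable_def by blast
  \<comment> \<open>The projections rebuild the argument list behind the searched variable; in
    \<open>h\<close> they skip the counter and the accumulated product.\<close>
  define g0 where "g0 xs = g (map (\<lambda>f. f xs) ((\<lambda>_. 0) # map (\<lambda>i xs. xs ! i) [0..<n]))" for xs
  define h where "h xs = xs ! 1 *
    g (map (\<lambda>f. f xs) ((\<lambda>xs. Suc (xs ! 0)) # map (\<lambda>i xs. xs ! (i + 2)) [0..<n]))" for xs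
  have g0: "recf n g0"
    unfolding g0_def by (rule recf_comp[OF g(1)]) (auto intro: recf_nth recf_const)
  have h: "recf (n + 2) h"
    unfolding h_def
    by (intro recf_mult recf_nth recf_comp[OF g(1)]) (auto intro: recf_nth recf_Suc)
  have g0_eq: "g0 xs = g (0 # xs)" if "length xs = n" for xs
    using that by (simp add: g0_def comp_def flip: that) (simp add: map_nth)
  have h_eq: "h (y # r # xs) = r * g (Suc y # xs)" if "length xs = n" for y r xs
    using that by (simp add: h_def comp_def flip: that) (simp add: map_nth)
  have zero_iff: "rec_nat (g0 xs) (\<lambda>y r. h (y # r # xs)) k = 0 \<longleftrightarrow> (\<exists>z\<le>k. g (z # xs) = 0)"
    if "length xs = n" for xs k
    by (induction k) (auto simp: g0_eq h_eq that le_Suc_eq)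
  have "recf n (\<lambda>xs. (\<lambda>ys. rec_nat (g0 (tl ys)) (\<lambda>y r. h (y # r # tl ys)) (hd ys))
      (map (\<lambda>f. f xs) (b # map (\<lambda>i xs. xs ! i) [0..<n])))"
    by (rule recf_comp[OF recf_prim[OF g0 h]]) (use assms(2) in \<open>auto intro: recf_nth\<close>)
  then have "recf n (\<lambda>xs. rec_nat (g0 xs) (\<lambda>y r. h (y # r # xs)) (b xs))"
    by (rule recf_cong) (auto simp: comp_def map_nth)
  with zero_iff g(2) show ?thesis
    unfolding decidable_def by fastforce
qed

lemma ce_decidable:
  assumes "decidable 2 (\<lambda>xs. P (xs ! 0) (xs ! 1))"
  shows "ce {x. \<exists>y. P x y}"
proof -
  from assms obtain f where "rec_in {} 2 f" "\<And>xs. length xs = 2 \<Longrightarrow> P (xs ! 0) (xs ! 1) \<longleftrightarrow> f xs = 0"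
    unfolding decidable_def recf_def by metis
  from this(1) this(2)[of "[_, _]"] show ?thesis
    unfolding ce_def by auto
qed

section \<open>A universal enumeration operator\<close>

text \<open>Elements from \<open>u\<close> on contribute multiples of \<open>2 ^ u\<close>, while
  those below contribute less than \<open>2 ^ u\<close> in total.\<close>

lemma set_encode_Int_lessThan:
  assumes "finite A"
  shows "set_encode (A \<inter> {..<u}) = set_encode A mod 2 ^ u"
proof -
  have "set_encode A = set_encode (A \<inter> {..<u}) + set_encode (A - {..<u})"
    unfolding set_encode_def using assms
    by (metis Diff_Int_distrib2 Int_Diff_Un Int_Diff_disjoint finite_Diff finite_Int
        sum.union_disjoint)
  moreover have "2 ^ u dvd set_encode (A - {..<u})"
    unfolding set_encode_def by (auto intro!: dvd_sum le_imp_power_dvd)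
  moreover have "set_encode (A \<inter> {..<u}) < 2 ^ u"
  proof -
    have "set_encode (A \<inter> {..<u}) \<le> (\<Sum>i<u. 2 ^ i)"
      unfolding set_encode_def by (intro sum_mono2) auto
    then show ?thesis using sum_power2[of u] by (simp add: atLeast0LessThan less_eq_iff_succ_less)
  qed
  ultimately show ?thesis by auto
qed

text \<open>\<open>str_code\<close> is bijective base 2 with digits 1 and 2. Lowering every digit by
  1 subtracts \<open>2 ^ length \<sigma> - 1\<close> and leaves the binary code of the positions of
  \<open>True\<close>.\<close>

lemma str_code_eq: "Suc (str_code \<sigma>) = 2 ^ length \<sigma> + set_encode {i. i < length \<sigma> \<and> \<sigma> ! i}"
proof -
  have sum: "set_encode {i. i < length \<sigma> \<and> \<sigma> ! i} = (\<Sum>i<length \<sigma>. if \<sigma> ! i then 2 ^ i else 0)" for \<sigma>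
    by (simp add: set_encode_def sum.If_cases Int_def)
  show ?thesis
    unfolding sum
  proof (induction \<sigma>)
    case (Cons b bs)
    have "(\<Sum>i<length (b # bs). if (b # bs) ! i then 2 ^ i else 0) =
        of_bool b + (\<Sum>i<length bs. if bs ! i then 2 ^ Suc i else (0 :: nat))"
      by (simp add: sum.lessThan_Suc_shift del: sum.lessThan_Suc power_Suc)
    also have "(\<Sum>i<length bs. if bs ! i then 2 ^ Suc i else (0 :: nat)) =
        2 * (\<Sum>i<length bs. if bs ! i then 2 ^ i else 0)"
      unfolding sum_distrib_left by (rule sum.cong) auto
    finally have "(\<Sum>i<length (b # bs). if (b # bs) ! i then 2 ^ i else 0) =
        of_bool b + 2 * (\<Sum>i<length bs. if bs ! i then 2 ^ i else (0 :: nat))" .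
    with Cons show ?case
      by (simp only: str_code.simps) simp
  qed simp
qed

text \<open>A number in the oracle set acts as a table: read as a finite set of triples \<open>(u, h, n)\<close>, it
  allows \<open>n\<close> to be enumerated from every oracle whose restriction to \<open>{..<u}\<close> has code \<open>h\<close>. Any
  countable family of open conditions can thus be hard-wired into the elements of the oracle set.\<close>
definition univ_op :: "(bool list \<times> nat) set" where
  "univ_op = {(\<sigma>, n). \<exists>q u. length \<sigma> = Suc q \<and> \<sigma> ! q \<and> u \<le> q \<and>
     prod_encode (u, prod_encode (set_encode {i. i < u \<and> \<sigma> ! i}, n)) \<in> set_decode q}"

text \<open>A string in the operator that is an initial segment of \<open>S\<close> ends at an
  element \<open>q\<close> of \<open>S\<close> and, as \<open>u \<le> q\<close>, determines
  \<open>S\<close> below \<open>u\<close>. Conversely the initial segment of length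
  \<open>q + 1\<close> serves.\<close>

lemma op_apply_univ_op:
  "op_apply univ_op S = {n. \<exists>q\<in>S. \<exists>u\<le>q.
     prod_encode (u, prod_encode (set_encode (S \<inter> {..<u}), n)) \<in> set_decode q}"
proof (intro equalityI subsetI CollectI)
  fix n assume "n \<in> op_apply univ_op S"
  then obtain \<sigma> q u where \<sigma>: "init_seg \<sigma> S" "length \<sigma> = Suc q" "\<sigma> ! q" "u \<le> q"
    "prod_encode (u, prod_encode (set_encode {i. i < u \<and> \<sigma> ! i}, n)) \<in> set_decode q"
    unfolding op_apply_def univ_op_def by auto
  moreover have "{i. i < u \<and> \<sigma> ! i} = S \<inter> {..<u}"
    using \<sigma>(1,2,4) unfolding init_seg_def by auto
  moreover have "q \<in> S"
    using \<sigma>(1-3) unfolding init_seg_def by auto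
  ultimately show "\<exists>q\<in>S. \<exists>u\<le>q.
     prod_encode (u, prod_encode (set_encode (S \<inter> {..<u}), n)) \<in> set_decode q"
    by auto
next
  fix n assume "n \<in> {n. \<exists>q\<in>S. \<exists>u\<le>q.
     prod_encode (u, prod_encode (set_encode (S \<inter> {..<u}), n)) \<in> set_decode q}"
  then obtain q u where q: "q \<in> S" "u \<le> q"
    "prod_encode (u, prod_encode (set_encode (S \<inter> {..<u}), n)) \<in> set_decode q" by blast
  let ?\<sigma> = "map (\<lambda>i. i \<in> S) [0..<Suc q]"
  have nth: "?\<sigma> ! i = (i \<in> S)" if "i \<le> q" for i
    using that by (subst nth_map) (auto simp del: upt_Suc)
  have "{i. i < u \<and> ?\<sigma> ! i} = S \<inter> {..<u}"
    using nth q(2) by (auto simp del: upt_Suc map_append)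
  then have "(?\<sigma>, n) \<in> univ_op"
    unfolding univ_op_def using nth[of q] q by (auto simp del: upt_Suc map_append)
  moreover have "init_seg ?\<sigma> S"
    unfolding init_seg_def using nth by (auto simp del: upt_Suc map_append)
  ultimately show "n \<in> op_apply univ_op S"
    unfolding op_apply_def by blast
qed

text \<open>Replaces decoding by a remainder and an odd quotient, so that only sums, products,
  powers and searches occur.\<close>

lemma mem_set_decode_iff:
  "p \<in> set_decode q \<longleftrightarrow> (\<exists>c r. q = r + 2 ^ p * (2 * c + 1) \<and> r < 2 ^ p)"
proof
  assume "p \<in> set_decode q"
  then obtain c where "q div 2 ^ p = 2 * c + 1"
    unfolding set_decode_def by (auto elim: oddE)
  then show "\<exists>c r. q = r + 2 ^ p * (2 * c + 1) \<and> r < 2 ^ p"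
    by (intro exI[of _ c] exI[of _ "q mod 2 ^ p"])
      (metis mod_mult_div_eq mod_less_divisor zero_less_numeral zero_less_power)
next
  assume "\<exists>c r. q = r + 2 ^ p * (2 * c + 1) \<and> r < 2 ^ p"
  then obtain c r where q: "q = r + 2 ^ p * (2 * c + 1)" "r < 2 ^ p" by blast
  then have "q div 2 ^ p = 2 * c + 1"
    by (simp only: div_mult_self2) simp
  then show "p \<in> set_decode q"
    by (simp add: set_decode_def)
qed

text \<open>With \<open>k\<close> the code of the oracle set below \<open>q\<close>, the string of length \<open>q + 1\<close> ending in \<open>True\<close>
  has code \<open>3 * 2 ^ q + k - 1\<close>; splitting \<open>k = h + 2 ^ u * a\<close> exposes the restriction \<open>h\<close> to
  \<open>{..<u}\<close>.\<close>
lemma univ_op_codes: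
  "prod_encode (s, n) \<in> (\<lambda>(\<sigma>, x). prod_encode (str_code \<sigma>, x)) ` univ_op \<longleftrightarrow>
    (\<exists>q u h a. Suc s = 3 * 2 ^ q + (h + 2 ^ u * a) \<and> h + 2 ^ u * a < 2 ^ q \<and> u \<le> q \<and> h < 2 ^ u \<and>
      prod_encode (u, prod_encode (h, n)) \<in> set_decode q)" (is "?L \<longleftrightarrow> ?R")
proof
  assume ?L
  then obtain \<sigma> q u where \<sigma>: "s = str_code \<sigma>" "length \<sigma> = Suc q" "\<sigma> ! q" "u \<le> q"
    "prod_encode (u, prod_encode (set_encode {i. i < u \<and> \<sigma> ! i}, n)) \<in> set_decode q"
    unfolding univ_op_def by auto
  define A where "A = {i. i < q \<and> \<sigma> ! i}"
  \<comment> \<open>Length \<open>q + 1\<close> contributes \<open>2 ^ (q + 1)\<close> and the final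
    \<open>True\<close> contributes \<open>2 ^ q\<close>, together \<open>3 * 2 ^ q\<close>.\<close>
  have "{i. i < length \<sigma> \<and> \<sigma> ! i} = insert q A"
    using \<sigma>(2,3) by (auto simp: A_def less_Suc_eq)
  then have "Suc s = 3 * 2 ^ q + set_encode A"
    using str_code_eq[of \<sigma>] \<sigma>(1,2) by (simp add: A_def)
  moreover have "A \<inter> {..<q} = A" "A \<inter> {..<u} = {i. i < u \<and> \<sigma> ! i}"
    using \<sigma>(4) by (auto simp: A_def)
  moreover have "finite A" by (simp add: A_def)
  ultimately have s: "Suc s = 3 * 2 ^ q + set_encode A"
    and "set_encode A = set_encode A mod 2 ^ q"
    and mod: "set_encode {i. i < u \<and> \<sigma> ! i} = set_encode A mod 2 ^ u"
    using set_encode_Int_lessThan[of A q] set_encode_Int_lessThan[of A u] by simp_all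
  then have less: "set_encode A < 2 ^ q"
    by (metis mod_less_divisor zero_less_numeral zero_less_power)
  show ?R
    using s less mod \<sigma>(4,5)
    by (intro exI[of _ q] exI[of _ u] exI[of _ "set_encode A mod 2 ^ u"]
        exI[of _ "set_encode A div 2 ^ u"]) simp
next
  assume ?R
  then obtain q u h a where k: "Suc s = 3 * 2 ^ q + (h + 2 ^ u * a)" "h + 2 ^ u * a < 2 ^ q"
    "u \<le> q" "h < 2 ^ u" "prod_encode (u, prod_encode (h, n)) \<in> set_decode q" by blast
  define A where "A = set_decode (h + 2 ^ u * a)"
  have "set_encode (A \<inter> {..<q}) = set_encode A"
    using k(2) set_encode_Int_lessThan[of A q] by (simp add: A_def)
  moreover have "finite A" by (simp add: A_def)
  ultimately have "A \<inter> {..<q} = A"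
    using set_encode_eq[of "A \<inter> {..<q}" A] by simp
  then have A: "i < q" if "i \<in> A" for i using that by blast
  define \<sigma> where "\<sigma> = map (\<lambda>i. i \<in> A) [0..<q] @ [True]"
  have "{i. i < length \<sigma> \<and> \<sigma> ! i} = insert q A"
    using A by (auto simp: \<sigma>_def nth_append split: if_splits)
  moreover have "q \<notin> A" "finite A" using A[of q] \<open>finite A\<close> by auto
  ultimately have code: "Suc (str_code \<sigma>) = Suc s"
    using k(1) str_code_eq[of \<sigma>] by (simp add: A_def \<sigma>_def)
  have "{i. i < u \<and> \<sigma> ! i} = A \<inter> {..<u}"
    using k(3) by (auto simp: \<sigma>_def nth_append)
  then have "set_encode {i. i < u \<and> \<sigma> ! i} = h"
    using set_encode_Int_lessThan[of A u] k(4) by (simp add: A_def)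
  moreover have "length \<sigma> = Suc q" "\<sigma> ! q"
    by (auto simp: \<sigma>_def nth_append)
  ultimately have "(\<sigma>, n) \<in> univ_op"
    unfolding univ_op_def using k(3,5) by auto
  with code show ?L
    by (auto intro!: image_eqI[of _ _ "(\<sigma>, n)"])
qed

text \<open>By \<open>univ_op_codes\<close> and \<open>mem_set_decode_iff\<close>, membership is a
  block of existential quantifiers over a decidable matrix \<open>P\<close>. One number
  \<open>y\<close> bounds them all, leaving bounded searches behind a single unbounded one.\<close>

lemma ce_operator_univ_op: "ce_operator univ_op"
proof -
  define P where "P s r c n a h u q x \<longleftrightarrow>
    x = prod_encode (s, n) \<and> Suc s = 3 * 2 ^ q + (h + 2 ^ u * a) \<and> h + 2 ^ u * a < 2 ^ q \<and>
    u \<le> q \<and> h < 2 ^ u \<and>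
    q = r + 2 ^ prod_encode (u, prod_encode (h, n)) * (2 * c + 1) \<and>
    r < 2 ^ prod_encode (u, prod_encode (h, n))" for s r c n a h u q x :: nat
  \<comment> \<open>The arguments are \<open>s, r, c, n, a, h, u, q, x, y\<close> in this order,
    with the common bound \<open>y\<close> last. Each step below quantifies the first one, so the
    index of \<open>y\<close> falls from 9 to 1.\<close>
  have "decidable 10 (\<lambda>v. P (v!0) (v!1) (v!2) (v!3) (v!4) (v!5) (v!6) (v!7) (v!8))"
    unfolding P_def
    by (intro decidable_conj decidable_eq decidable_less decidable_le recf_prod_encode recf_Suc
        recf_add recf_mult recf_pow2 recf_const recf_nth) simp_all
  then have "decidable (Suc 9) (\<lambda>v. P (v!0) (v!1) (v!2) (v!3) (v!4) (v!5) (v!6) (v!7) (v!8))" by simp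
  from decidable_bex[OF this recf_nth[of 8]]
  have "decidable (Suc 8) (\<lambda>v. \<exists>s\<le>v!8. P s (v!0) (v!1) (v!2) (v!3) (v!4) (v!5) (v!6) (v!7))" by simp
  from decidable_bex[OF this recf_nth[of 7]]
  have "decidable (Suc 7) (\<lambda>v. \<exists>r\<le>v!7. \<exists>s\<le>v!7. P s r (v!0) (v!1) (v!2) (v!3) (v!4) (v!5) (v!6))"
    by simp
  from decidable_bex[OF this recf_nth[of 6]]
  have "decidable (Suc 6) (\<lambda>v. \<exists>c\<le>v!6. \<exists>r\<le>v!6. \<exists>s\<le>v!6. P s r c (v!0) (v!1) (v!2) (v!3) (v!4) (v!5))"
    by simp
  from decidable_bex[OF this recf_nth[of 5]]
  have "decidable (Suc 5) (\<lambda>v. \<exists>n\<le>v!5. \<exists>c\<le>v!5. \<exists>r\<le>v!5. \<exists>s\<le>v!5.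
      P s r c n (v!0) (v!1) (v!2) (v!3) (v!4))"
    by simp
  from decidable_bex[OF this recf_nth[of 4]]
  have "decidable (Suc 4) (\<lambda>v. \<exists>a\<le>v!4. \<exists>n\<le>v!4. \<exists>c\<le>v!4. \<exists>r\<le>v!4. \<exists>s\<le>v!4.
      P s r c n a (v!0) (v!1) (v!2) (v!3))"
    by simp
  from decidable_bex[OF this recf_nth[of 3]]
  have "decidable (Suc 3) (\<lambda>v. \<exists>h\<le>v!3. \<exists>a\<le>v!3. \<exists>n\<le>v!3. \<exists>c\<le>v!3. \<exists>r\<le>v!3. \<exists>s\<le>v!3.
      P s r c n a h (v!0) (v!1) (v!2))"
    by simp
  from decidable_bex[OF this recf_nth[of 2]]
  have "decidable (Suc 2) (\<lambda>v. \<exists>u\<le>v!2. \<exists>h\<le>v!2. \<exists>a\<le>v!2. \<exists>n\<le>v!2. \<exists>c\<le>v!2. \<exists>r\<le>v!2. \<exists>s\<le>v!2.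
      P s r c n a h u (v!0) (v!1))"
    by simp
  from decidable_bex[OF this recf_nth[of 1]]
  have "decidable 2 (\<lambda>v. \<exists>q\<le>v!1. \<exists>u\<le>v!1. \<exists>h\<le>v!1. \<exists>a\<le>v!1. \<exists>n\<le>v!1. \<exists>c\<le>v!1. \<exists>r\<le>v!1. \<exists>s\<le>v!1.
      P s r c n a h u q (v!0))"
    by simp
  then have "ce {x. \<exists>y. \<exists>q\<le>y. \<exists>u\<le>y. \<exists>h\<le>y. \<exists>a\<le>y. \<exists>n\<le>y. \<exists>c\<le>y. \<exists>r\<le>y. \<exists>s\<le>y. P s r c n a h u q x}"
    by (rule ce_decidable)
  also have "{x. \<exists>y. \<exists>q\<le>y. \<exists>u\<le>y. \<exists>h\<le>y. \<exists>a\<le>y. \<exists>n\<le>y. \<exists>c\<le>y. \<exists>r\<le>y. \<exists>s\<le>y. P s r c n a h u q x} =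
    {x. \<exists>q u h a n c r s. P s r c n a h u q x}"
  proof -
    have "\<exists>y. \<exists>q\<le>y. \<exists>u\<le>y. \<exists>h\<le>y. \<exists>a\<le>y. \<exists>n\<le>y. \<exists>c\<le>y. \<exists>r\<le>y. \<exists>s\<le>y. P s r c n a h u q x"
      if "P s r c n a h u q x" for s r c n a h u q x
      by (rule exI[of _ "s + r + c + n + a + h + u + q"],
          rule exI[of _ q], rule conjI, simp, rule exI[of _ u], rule conjI, simp,
          rule exI[of _ h], rule conjI, simp, rule exI[of _ a], rule conjI, simp,
          rule exI[of _ n], rule conjI, simp, rule exI[of _ c], rule conjI, simp,
          rule exI[of _ r], rule conjI, simp, rule exI[of _ s], rule conjI, simp, rule that)
    then show ?thesis
      by (intro Collect_cong iffI; elim exE conjE) (intro exI, assumption, assumption)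
  qed
  also have "\<dots> = (\<lambda>(\<sigma>, x). prod_encode (str_code \<sigma>, x)) ` univ_op"
  proof (rule set_eqI)
    fix x
    obtain s n where "prod_decode x = (s, n)" by fastforce
    then have x: "x = prod_encode (s, n)" by (metis prod_decode_inverse)
    show "x \<in> {x. \<exists>q u h a n c r s. P s r c n a h u q x} \<longleftrightarrow>
        x \<in> (\<lambda>(\<sigma>, x). prod_encode (str_code \<sigma>, x)) ` univ_op"
      unfolding x univ_op_codes mem_set_decode_iff P_def mem_Collect_eq prod_encode_eq prod.inject
      by blast
  qed
  finally show ?thesis
    unfolding ce_operator_def .
qed

text \<open>\<open>K\<close> lists the facts that a finite restriction forces membership in
  \<open>U n\<close>. The tables decode to finite parts of \<open>K\<close>, so nothing false is
  enumerated; an infinite set of tables contains late ones, so every true fact is eventually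
  used.\<close>

lemma open_family_enumerated:
  fixes U :: "nat \<Rightarrow> nat set set"
  assumes "\<And>n S. S \<in> U n \<Longrightarrow> \<exists>u. \<forall>T. T \<inter> {..<u} = S \<inter> {..<u} \<longrightarrow> T \<in> U n"
  obtains Q where "infinite Q"
    "\<And>S. S \<subseteq> Q \<Longrightarrow> infinite S \<Longrightarrow> op_apply univ_op S = {n. S \<in> U n}"
proof -
  define K where "K = {prod_encode (u, prod_encode (h, n)) | u h n.
    \<forall>T. T \<inter> {..<u} = set_decode h \<longrightarrow> T \<in> U n}"
  have code_in_K: "prod_encode (u, prod_encode (h, n)) \<in> K \<longleftrightarrow>
    (\<forall>T. T \<inter> {..<u} = set_decode h \<longrightarrow> T \<in> U n)" for u h n
    by (auto simp: K_def)
  \<comment> \<open>For \<open>u = 0\<close> and a nonempty coded set no \<open>T\<close> matches,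
    so the fact holds vacuously. Hence \<open>K\<close> is infinite and there are infinitely many
    tables.\<close>
  have "infinite K"
  proof -
    have "{} \<noteq> set_decode (Suc k)" for k
      by (metis Zero_not_Suc set_decode_inverse set_encode_empty)
    then have "range (\<lambda>k. prod_encode (0, prod_encode (Suc k, 0))) \<subseteq> K"
      by (auto simp: code_in_K)
    moreover have "infinite (range (\<lambda>k. prod_encode (0, prod_encode (Suc k, 0))))"
      by (subst finite_image_iff) (auto simp: inj_def)
    ultimately show ?thesis using finite_subset by blast
  qed
  define q where "q m = set_encode (K \<inter> {..<m})" for m
  have decode_q: "set_decode (q m) = K \<inter> {..<m}" for m
    by (simp add: q_def)
  have "K \<subseteq> (\<Union>x\<in>range q. set_decode x)"
    using decode_q by (auto intro: lessI)
  with \<open>infinite K\<close> have "infinite (range q)"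
    by (meson finite_UN_I finite_set_decode finite_subset)
  moreover have "op_apply univ_op S = {n. S \<in> U n}" if S: "S \<subseteq> range q" "infinite S" for S
  proof (intro equalityI subsetI CollectI)
    fix n assume "n \<in> op_apply univ_op S"
    then obtain x u where "x \<in> S"
      "prod_encode (u, prod_encode (set_encode (S \<inter> {..<u}), n)) \<in> set_decode x"
      unfolding op_apply_univ_op by blast
    with S(1) have "prod_encode (u, prod_encode (set_encode (S \<inter> {..<u}), n)) \<in> K"
      using decode_q by blast
    then show "S \<in> U n"
      by (simp add: code_in_K)
  next
    fix n assume "n \<in> {n. S \<in> U n}"
    with assms obtain u where "\<forall>T. T \<inter> {..<u} = S \<inter> {..<u} \<longrightarrow> T \<in> U n" by blast
    define c where "c = prod_encode (u, prod_encode (set_encode (S \<inter> {..<u}), n))"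
    have "c \<in> K"
      unfolding c_def code_in_K using \<open>\<forall>T. _ T\<close> by simp
    \<comment> \<open>All but finitely many elements of \<open>S\<close> are at least
      \<open>u\<close>, as the operator demands, and are tables from stages beyond \<open>c\<close>,
      which contain \<open>c\<close>.\<close>
    have "infinite (S - ({..<u} \<union> q ` {..c}))"
      using S(2) by (intro Diff_infinite_finite) auto
    then obtain x where x: "x \<in> S" "u \<le> x" "x \<notin> q ` {..c}"
      by (metis Diff_iff Un_iff finite.emptyI ex_in_conv lessThan_iff not_le)
    from x(1) S(1) obtain m where "x = q m" by blast
    with x(3) have "c < m" by (meson atMost_iff image_eqI not_le)
    then have "c \<in> set_decode x"
      using \<open>c \<in> K\<close> \<open>x = q m\<close> by (simp add: decode_q)
    then show "n \<in> op_apply univ_op S"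
      unfolding op_apply_univ_op c_def using x by blast
  qed
  ultimately show thesis using that by blast
qed

section \<open>The Ramsey property of open sets\<close>

lemma infinite_above:
  fixes B s :: "nat set"
  assumes "infinite B" "finite s"
  shows "infinite {b \<in> B. \<forall>a\<in>s. a < b}"
proof -
  have "B \<subseteq> {b \<in> B. \<forall>a\<in>s. a < b} \<union> (\<Union>a\<in>s. {..a})"
    by force
  then show ?thesis
    using assms by (meson finite_UN_I finite_Un finite_atMost finite_subset)
qed

text \<open>\<open>B\<close> arises by moving an element of the current reservoir into a finite stem
  and shrinking the reservoir until \<open>P\<close> holds for every subset of the new stem. The
  part of \<open>B\<close> above a finite set lies in the reservoir of the first stage whose stem
  includes that set.\<close>

lemma fusion:
  fixes X :: "nat set" and P :: "nat set \<Rightarrow> nat set \<Rightarrow> bool"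
  assumes X: "infinite X"
    and mono: "\<And>s Y Z. P s Y \<Longrightarrow> Z \<subseteq> Y \<Longrightarrow> P s Z"
    and dense: "\<And>s Y. finite s \<Longrightarrow> s \<subseteq> X \<Longrightarrow> Y \<subseteq> X \<Longrightarrow> infinite Y \<Longrightarrow> \<exists>Z\<subseteq>Y. infinite Z \<and> P s Z"
  obtains B where "B \<subseteq> X" "infinite B"
    "\<And>s. finite s \<Longrightarrow> s \<subseteq> B \<Longrightarrow> P s {b \<in> B. \<forall>a\<in>s. a < b}"
proof -
  have dense_family: "\<exists>Z\<subseteq>Y. infinite Z \<and> (\<forall>t\<in>T. P t Z)"
    if "finite T" "\<And>t. t \<in> T \<Longrightarrow> finite t \<and> t \<subseteq> X" "Y \<subseteq> X" "infinite Y" for T Y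
    using that
  proof (induction T rule: finite_induct)
    case (insert t T)
    then obtain Z where Z: "Z \<subseteq> Y" "infinite Z" "\<forall>t\<in>T. P t Z" by blast
    with insert.prems dense[of t Z] obtain Z' where "Z' \<subseteq> Z" "infinite Z'" "P t Z'" by blast
    with Z mono show ?case by (intro exI[of _ Z']) blast
  qed auto
  define I where "I p \<longleftrightarrow> finite (fst p) \<and> fst p \<subseteq> X \<and> snd p \<subseteq> X \<and> infinite (snd p) \<and>
    (\<forall>a\<in>fst p. \<forall>y\<in>snd p. a < y) \<and> (\<forall>t\<subseteq>fst p. P t (snd p))" for p :: "nat set \<times> nat set"
  define R where "R p p' \<longleftrightarrow> (\<exists>x\<in>snd p. fst p' = insert x (fst p)) \<and> snd p' \<subseteq> snd p"
    for p p' :: "nat set \<times> nat set"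
  have "\<exists>f. \<forall>k. (I (f k) \<and> (k = 0 \<longrightarrow> fst (f k) = {})) \<and> R (f k) (f (Suc k))"
  proof (rule dependent_nat_choice)
    from dense[of "{}" X] X obtain Z where "Z \<subseteq> X" "infinite Z" "P {} Z" by auto
    then have "I ({}, Z)" by (auto simp: I_def)
    then show "\<exists>p. I p \<and> (0 = (0::nat) \<longrightarrow> fst p = {})" by force
  next
    fix p :: "nat set \<times> nat set" and k :: nat
    assume "I p \<and> (k = 0 \<longrightarrow> fst p = {})"
    then have p: "finite (fst p)" "fst p \<subseteq> X" "snd p \<subseteq> X" "infinite (snd p)"
      "\<forall>a\<in>fst p. \<forall>y\<in>snd p. a < y" by (auto simp: I_def)
    from p(4) obtain x where x: "x \<in> snd p" by (metis finite.emptyI ex_in_conv)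
    let ?Y = "{y \<in> snd p. \<forall>a\<in>{x}. a < y}"
    have "infinite ?Y" using p(4) by (rule infinite_above) simp
    have "\<exists>Z\<subseteq>?Y. infinite Z \<and> (\<forall>t\<in>Pow (insert x (fst p)). P t Z)"
    proof (rule dense_family)
      show "finite t \<and> t \<subseteq> X" if "t \<in> Pow (insert x (fst p))" for t
        using that p(1-3) x by (auto intro: finite_subset)
    qed (use p(1,3) \<open>infinite ?Y\<close> in auto)
    then obtain Z where "Z \<subseteq> ?Y" "infinite Z" "\<forall>t\<in>Pow (insert x (fst p)). P t Z" by blast
    then have "I (insert x (fst p), Z)" "R p (insert x (fst p), Z)"
      using p x by (auto simp: I_def R_def)
    then show "\<exists>p'. (I p' \<and> (Suc k = 0 \<longrightarrow> fst p' = {})) \<and> R p p'" by blast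
  qed
  then obtain f where I: "\<And>k. I (f k)" and f0: "fst (f 0) = {}" and R: "\<And>k. R (f k) (f (Suc k))"
    by auto
  define s Y where "s k = fst (f k)" and "Y k = snd (f k)" for k
  have s: "finite (s k)" "s k \<subseteq> X" and sY: "\<And>a y. a \<in> s k \<Longrightarrow> y \<in> Y k \<Longrightarrow> a < y"
    and P: "\<And>t. t \<subseteq> s k \<Longrightarrow> P t (Y k)" for k
    using I[of k] unfolding I_def s_def Y_def by blast+
  have step: "\<exists>x\<in>Y k. s (Suc k) = insert x (s k)" "Y (Suc k) \<subseteq> Y k" for k
    using R[of k] unfolding R_def s_def Y_def by blast+
  define B where "B = (\<Union>k. s k)"
  have s_mono: "s j \<subseteq> s k" if "j \<le> k" for j k
  proof (rule lift_Suc_mono_le[OF _ that])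
    show "s i \<subseteq> s (Suc i)" for i using step(1)[of i] by blast
  qed
  have later: "s (k + j) \<subseteq> s k \<union> Y k \<and> Y (k + j) \<subseteq> Y k" for k j
  proof (induction j)
    case (Suc j)
    from step(1)[of "k + j"] obtain x where "x \<in> Y (k + j)" "s (Suc (k + j)) = insert x (s (k + j))"
      by blast
    with Suc step(2)[of "k + j"] show ?case by auto
  qed simp
  have "s j \<subseteq> s k \<union> Y k" for j k
  proof (cases "j \<le> k")
    case True
    then show ?thesis using s_mono by blast
  next
    case False
    then show ?thesis using later[of k "j - k"] by simp
  qed
  then have B_sub: "B \<subseteq> s k \<union> Y k" for k
    unfolding B_def by blast
  have "card (s k) = k" for k
  proof (induction k)
    case 0
    show ?case using f0 by (simp add: s_def)
  next
    case (Suc k)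
    from step(1)[of k] obtain x where x: "x \<in> Y k" "s (Suc k) = insert x (s k)" by blast
    with sY[of x k x] have "x \<notin> s k" by blast
    with Suc s(1)[of k] show ?case unfolding x(2) by simp
  qed
  then have "finite B \<Longrightarrow> Suc (card B) \<le> card B"
    using card_mono[of B "s (Suc (card B))"] by (auto simp: B_def)
  then have "infinite B" by auto
  moreover have "P t {b \<in> B. \<forall>a\<in>t. a < b}" if t: "finite t" "t \<subseteq> B" for t
  proof -
    have "\<exists>k. t \<subseteq> s k"
      using t
    proof (induction t rule: finite_induct)
      case (insert x t)
      then obtain j k where "t \<subseteq> s j" "x \<in> s k" by (auto simp: B_def)
      then have "insert x t \<subseteq> s (max j k)"
        using s_mono[of j "max j k"] s_mono[of k "max j k"] by auto
      then show ?case ..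
    qed simp
    \<comment> \<open>If \<open>k > 0\<close>, the element added last belongs to \<open>t\<close>
      and is the largest of the stem, so whatever lies above \<open>t\<close> is outside the stem
      and hence in the reservoir.\<close>
    define k where "k = (LEAST k. t \<subseteq> s k)"
    have k: "t \<subseteq> s k" "\<And>j. j < k \<Longrightarrow> \<not> t \<subseteq> s j"
      unfolding k_def using \<open>\<exists>k. t \<subseteq> s k\<close> by (rule LeastI_ex) (rule not_less_Least)
    have "{b \<in> B. \<forall>a\<in>t. a < b} \<subseteq> Y k"
    proof (cases k)
      case 0
      then show ?thesis using B_sub[of 0] f0 by (auto simp: s_def)
    next
      case (Suc j)
      from step(1)[of j] obtain x where x: "x \<in> Y j" "s k = insert x (s j)"
        using Suc by auto
      have "\<not> t \<subseteq> s j" using k(2) Suc by simp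
      moreover have "t \<subseteq> insert x (s j)" using k(1) x(2) by simp
      ultimately have "x \<in> t" by blast
      have "b \<le> x" if "b \<in> s k" for b
        using that x sY[of b j x] by auto
      with \<open>x \<in> t\<close> have "b \<notin> s k" if "\<forall>a\<in>t. a < b" for b
        using that by (meson not_le)
      then show ?thesis using B_sub[of k] by blast
    qed
    with P[OF k(1)] show ?thesis by (rule mono)
  qed
  moreover have "B \<subseteq> X"
    using s(2) by (auto simp: B_def)
  ultimately show thesis using that by blast
qed

theorem open_ramsey:
  fixes X :: "nat set"
  assumes X: "infinite X"
    and opn: "\<And>S. S \<in> U \<Longrightarrow> \<exists>u. \<forall>T. T \<inter> {..<u} = S \<inter> {..<u} \<longrightarrow> T \<in> U"
  obtains Y where "Y \<subseteq> X" "infinite Y"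
    "(\<forall>S\<subseteq>Y. infinite S \<longrightarrow> S \<in> U) \<or> (\<forall>S\<subseteq>Y. infinite S \<longrightarrow> S \<notin> U)"
proof -
  \<comment> \<open>Nash-Williams' accept/reject argument\<close>
  define acc where "acc s Y \<longleftrightarrow>
    (\<forall>D\<subseteq>Y. infinite D \<longrightarrow> (\<forall>a\<in>s. \<forall>d\<in>D. a < d) \<longrightarrow> s \<union> D \<in> U)" for s Y :: "nat set"
  define rej where "rej s Y \<longleftrightarrow> (\<forall>Z\<subseteq>Y. infinite Z \<longrightarrow> \<not> acc s Z)" for s Y
  have acc_mono: "acc s Z" if "acc s Y" "Z \<subseteq> Y" for s Y Z
    using that unfolding acc_def by (meson subset_trans)
  have rej_mono: "rej s Z" if "rej s Y" "Z \<subseteq> Y" for s Y Z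
    using that unfolding rej_def by (meson subset_trans)
  have acc_above: "acc s Y" if "acc s {b \<in> Y. \<forall>a\<in>s. a < b}" for s Y
    unfolding acc_def
  proof (intro allI impI)
    fix D assume D: "D \<subseteq> Y" "infinite D" "\<forall>a\<in>s. \<forall>d\<in>D. a < d"
    then have "D \<subseteq> {b \<in> Y. \<forall>a\<in>s. a < b}" by auto
    with that D show "s \<union> D \<in> U" unfolding acc_def by simp
  qed
  \<comment> \<open>Fusion makes every finite subset of \<open>Y\<close> decided by the part of
    \<open>Y\<close> above it.\<close>
  obtain Y where Y: "Y \<subseteq> X" "infinite Y" and
    dec: "\<And>s. finite s \<Longrightarrow> s \<subseteq> Y \<Longrightarrow> acc s {b \<in> Y. \<forall>a\<in>s. a < b} \<or> rej s {b \<in> Y. \<forall>a\<in>s. a < b}"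
  proof (rule fusion[OF X, where P = "\<lambda>s Y. acc s Y \<or> rej s Y"])
    fix s Y Z assume "acc s Y \<or> rej s Y" "Z \<subseteq> Y"
    then show "acc s Z \<or> rej s Z" using acc_mono rej_mono by blast
  next
    fix s Y :: "nat set" assume "infinite Y"
    then show "\<exists>Z\<subseteq>Y. infinite Z \<and> (acc s Z \<or> rej s Z)"
      unfolding rej_def by blast
  qed blast
  \<comment> \<open>Acceptance speaks only of sets above \<open>s\<close>, so the decision carries
    over to \<open>Y\<close> itself.\<close>
  have dec: "acc s Y \<or> rej s Y" if "finite s" "s \<subseteq> Y" for s
    using dec[OF that]
  proof
    assume r: "rej s {b \<in> Y. \<forall>a\<in>s. a < b}"
    have "\<not> acc s Z" if "Z \<subseteq> Y" "infinite Z" for Z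
    proof
      assume "acc s Z"
      then have "acc s {b \<in> Z. \<forall>a\<in>s. a < b}" by (rule acc_mono) auto
      moreover have "{b \<in> Z. \<forall>a\<in>s. a < b} \<subseteq> {b \<in> Y. \<forall>a\<in>s. a < b}" using \<open>Z \<subseteq> Y\<close> by blast
      ultimately show False
        using r infinite_above[OF \<open>infinite Z\<close> \<open>finite s\<close>] unfolding rej_def by blast
    qed
    then show ?thesis unfolding rej_def by blast
  qed (use acc_above in blast)
  show thesis
  proof (cases "acc {} Y")
    case True
    then have "\<forall>S\<subseteq>Y. infinite S \<longrightarrow> S \<in> U"
      unfolding acc_def by auto
    with Y that show thesis by blast
  next
    case False
    with dec[of "{}"] have rej_empty: "rej {} Y" by simp
    \<comment> \<open>A second fusion: for finite subsets of \<open>Z\<close>, rejection persists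
      when one larger element of \<open>Z\<close> is added.\<close>
    obtain Z where Z: "Z \<subseteq> Y" "infinite Z" and
      Z_rej: "\<And>s. finite s \<Longrightarrow> s \<subseteq> Z \<Longrightarrow>
        rej s Y \<longrightarrow> (\<forall>z\<in>{b \<in> Z. \<forall>a\<in>s. a < b}. (\<forall>a\<in>s. a < z) \<longrightarrow> rej (insert z s) Y)"
    proof (rule fusion[OF Y(2), where
          P = "\<lambda>s Z. rej s Y \<longrightarrow> (\<forall>z\<in>Z. (\<forall>a\<in>s. a < z) \<longrightarrow> rej (insert z s) Y)"])
      fix s W assume s: "finite s" "s \<subseteq> Y" and W: "W \<subseteq> Y" "infinite W"
      \<comment> \<open>Were \<open>V\<close> infinite, it would accept a rejected \<open>s\<close>:
        an infinite \<open>D \<subseteq> V\<close> above \<open>s\<close> has a least element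
        \<open>z\<close>, and \<open>insert z s\<close> is accepted by \<open>Y\<close>, being
        decided and not rejected.\<close>
      define V where "V = {z \<in> W. (\<forall>a\<in>s. a < z) \<and> \<not> rej (insert z s) Y}"
      show "\<exists>Z\<subseteq>W. infinite Z \<and> (rej s Y \<longrightarrow> (\<forall>z\<in>Z. (\<forall>a\<in>s. a < z) \<longrightarrow> rej (insert z s) Y))"
      proof (cases "rej s Y")
        case True
        have "finite V"
        proof (rule ccontr)
          assume "infinite V"
          have "acc s V"
            unfolding acc_def
          proof (intro allI impI)
            fix D assume D: "D \<subseteq> V" "infinite D" "\<forall>a\<in>s. \<forall>d\<in>D. a < d"
            define z where "z = (LEAST z. z \<in> D)"
            have "z \<in> D"
              unfolding z_def using D(2) by (metis LeastI finite.emptyI ex_in_conv)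
            have z_le: "z \<le> d" if "d \<in> D" for d
              unfolding z_def using that by (rule Least_le)
            have "acc (insert z s) Y"
              using dec[of "insert z s"] s D(1) W(1) \<open>z \<in> D\<close> by (auto simp: V_def)
            moreover have "D - {z} \<subseteq> Y" "infinite (D - {z})"
              using D W(1) by (auto simp: V_def)
            moreover have "\<forall>a\<in>insert z s. \<forall>d\<in>D - {z}. a < d"
              using D(3) z_le by (auto simp: le_neq_implies_less)
            ultimately have "insert z s \<union> (D - {z}) \<in> U"
              unfolding acc_def by blast
            moreover have "insert z s \<union> (D - {z}) = s \<union> D"
              using \<open>z \<in> D\<close> by blast
            ultimately show "s \<union> D \<in> U" by simp
          qed
          moreover have "V \<subseteq> Y" using W(1) by (auto simp: V_def)
          ultimately show False
            using True \<open>infinite V\<close> unfolding rej_def by blast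
        qed
        with W(2) have "infinite (W - V)" by simp
        then show ?thesis
          by (intro exI[of _ "W - V"]) (auto simp: V_def)
      qed (use W in blast)
    qed blast+
    have all_rej: "rej s Y" if "finite s" "s \<subseteq> Z" for s
      using that
    proof (induction s rule: finite_linorder_max_induct)
      case (insert b A)
      then show ?case using Z_rej[of A] by auto
    qed (rule rej_empty)
    have "S \<notin> U" if "S \<subseteq> Z" "infinite S" for S
    proof
      assume "S \<in> U"
      \<comment> \<open>By openness some finite initial segment of \<open>S\<close> is accepted by
        the remainder of \<open>S\<close>, whereas all finite subsets of \<open>Z\<close> are
        rejected.\<close>
      from opn[OF this] obtain u where u: "\<forall>T. T \<inter> {..<u} = S \<inter> {..<u} \<longrightarrow> T \<in> U" by blast
      have "acc (S \<inter> {..<u}) (S - {..<u})"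
        unfolding acc_def using u by (auto intro!: u[rule_format])
      moreover have "infinite (S - {..<u})" "S - {..<u} \<subseteq> Y"
        using that Z(1) by auto
      moreover have "rej (S \<inter> {..<u}) Y"
        using that(1) by (intro all_rej) auto
      ultimately show False
        unfolding rej_def by blast
    qed
    with Y Z that show thesis by (metis order_trans)
  qed
qed

section \<open>Deleting the first elements of a set\<close>

text \<open>This is \<open>S\<close> without its \<open>n\<close> least elements. Counting
  predecessors makes membership of \<open>x\<close> depend only on \<open>S\<close> up to
  \<open>x\<close>.\<close>

definition rest :: "nat \<Rightarrow> nat set \<Rightarrow> nat set" where
  "rest n S = {x \<in> S. n \<le> card (S \<inter> {..<x})}"

lemma rest_subset: "rest n S \<subseteq> S"
  by (auto simp: rest_def)

text \<open>Each element has at least as many predecessors in the larger set.\<close>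

lemma rest_mono: "S \<subseteq> T \<Longrightarrow> rest n S \<subseteq> rest n T"
  unfolding rest_def by (auto elim!: order_trans intro!: card_mono)

text \<open>Continuity of \<open>rest n\<close>: preimages of open conditions under it are
  open.\<close>

lemma rest_Int_lessThan:
  assumes "T \<inter> {..<u} = S \<inter> {..<u}"
  shows "rest n T \<inter> {..<u} = rest n S \<inter> {..<u}"
proof -
  have "T \<inter> {..<x} = S \<inter> {..<x}" if "x < u" for x
  proof -
    have "{..<x} = {..<u} \<inter> {..<x}" using that by auto
    then show ?thesis using assms by (metis Int_assoc)
  qed
  moreover have "x \<in> T \<longleftrightarrow> x \<in> S" if "x < u" for x
    using assms that by blast
  ultimately show ?thesis
    unfolding rest_def by auto
qed

text \<open>Links \<open>rest\<close> to the parts above a finite set that \<open>fusion\<close>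
  controls.\<close>

lemma rest_eq_above:
  assumes "infinite S"
  obtains s where "finite s" "s \<subseteq> S" "card s = n" "rest n S = {b \<in> S. \<forall>a\<in>s. a < b}" "s \<union> rest n S = S"
proof
  let ?s = "enumerate S ` {..<n}"
  have mono: "enumerate S i < enumerate S j \<longleftrightarrow> i < j" for i j
    using strict_mono_enumerate[OF assms] by (simp add: strict_mono_less)
  have seg: "S \<inter> {..<enumerate S k} = enumerate S ` {..<k}" for k
    using mono by (subst range_enumerate[OF assms, symmetric]) auto
  have card: "card (enumerate S ` {..<k}) = k" for k
    using strict_mono_enumerate[OF assms] by (subst card_image) (auto intro: strict_mono_imp_inj_on inj_on_subset)
  show "rest n S = {b \<in> S. \<forall>a\<in>?s. a < b}"
  proof (rule set_eqI)
    fix x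
    show "x \<in> rest n S \<longleftrightarrow> x \<in> {b \<in> S. \<forall>a\<in>?s. a < b}"
    proof (cases "x \<in> S")
      case True
      then obtain k where k: "x = enumerate S k"
        using range_enumerate[OF assms] by blast
      have "n \<le> k \<longleftrightarrow> (\<forall>i<n. i < k)"
        by (meson less_irrefl not_le order_less_le_trans)
      then show ?thesis
        using True unfolding rest_def k
          by (simp only: seg card mem_Collect_eq simp_thms ball_simps lessThan_iff mono
              Ball_def[of "{..<n}"])
    qed (simp add: rest_def)
  qed
  show "?s \<union> rest n S = S"
  proof (intro equalityI subsetI)
    fix x assume "x \<in> S"
    then obtain k where k: "x = enumerate S k"
      using range_enumerate[OF assms] by blast
    show "x \<in> ?s \<union> rest n S"
    proof (cases "k < n")
      case True
      then show ?thesis unfolding k by blast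
    next
      case False
      then show ?thesis using \<open>x \<in> S\<close> unfolding k rest_def by (simp add: seg card)
    qed
  qed (use range_enumerate[OF assms] rest_subset in blast)
  show "card ?s = n" by (rule card)
  show "?s \<subseteq> S" using range_enumerate[OF assms] by auto
qed simp

lemma infinite_rest: "infinite S \<Longrightarrow> infinite (rest n S)"
  by (metis infinite_above rest_eq_above)

section \<open>Enumerating a set that sparse subsets do not compute\<close>

text \<open>The argument \<open>n\<close> doubles as the name of the functional \<open>S \<mapsto> \<Phi>\<^sub>e(t \<union> S)\<close>, so that every
  reduction can be refuted at its own name.\<close>
definition converges0 :: "nat \<Rightarrow> nat set set" where
  "converges0 n = (case prod_decode n of (e, t) \<Rightarrow> {S. phi e (set_decode t \<union> S) n 0})"

lemma mem_converges0:
  "S \<in> converges0 (prod_encode (e, t)) \<longleftrightarrow> phi e (set_decode t \<union> S) (prod_encode (e, t)) 0"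
  by (simp add: converges0_def)

lemma open_converges0:
  assumes "S \<in> converges0 n"
  shows "\<exists>u. \<forall>T. T \<inter> {..<u} = S \<inter> {..<u} \<longrightarrow> T \<in> converges0 n"
proof -
  obtain e t where n: "prod_decode n = (e, t)" by fastforce
  from assms n have "phi e (set_decode t \<union> S) n 0" by (simp add: converges0_def)
  from phi_use[OF this] obtain u where
    u: "\<And>Y. Y \<inter> {..<u} = (set_decode t \<union> S) \<inter> {..<u} \<Longrightarrow> phi e Y n 0" by (metis order_refl)
  have "T \<in> converges0 n" if "T \<inter> {..<u} = S \<inter> {..<u}" for T
    using u[of "set_decode t \<union> T"] that n by (simp add: converges0_def Int_Un_distrib2)
  then show ?thesis by blast
qed

lemma enumerated_not_computed:
  obtains A B where "infinite A" "infinite B"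
    "\<And>S. S \<subseteq> B \<Longrightarrow> infinite S \<Longrightarrow> op_apply univ_op S = A"
    "\<And>C. C \<subseteq> B \<Longrightarrow> infinite C \<Longrightarrow> \<exists>D\<subseteq>C. infinite D \<and> \<not> turing_le A D"
proof -
  have "\<exists>u. \<forall>T. T \<inter> {..<u} = S \<inter> {..<u} \<longrightarrow> T \<in> {S. rest n S \<in> converges0 n}"
    if "S \<in> {S. rest n S \<in> converges0 n}" for n S
  proof -
    from that open_converges0 obtain u where
      "\<forall>T. T \<inter> {..<u} = rest n S \<inter> {..<u} \<longrightarrow> T \<in> converges0 n" by blast
    then show ?thesis using rest_Int_lessThan by (metis mem_Collect_eq)
  qed
  then obtain Q where Q: "infinite Q" and
    enum: "\<And>S. S \<subseteq> Q \<Longrightarrow> infinite S \<Longrightarrow> op_apply univ_op S = {n. rest n S \<in> converges0 n}"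
    by (rule open_family_enumerated[of "\<lambda>n. {S. rest n S \<in> converges0 n}"]) auto
  define homog where "homog n Y \<longleftrightarrow> (\<forall>S\<subseteq>Y. infinite S \<longrightarrow> S \<in> converges0 n) \<or>
    (\<forall>S\<subseteq>Y. infinite S \<longrightarrow> S \<notin> converges0 n)" for n Y
  \<comment> \<open>The requirement depends only on \<open>card s\<close>. Applied to the first
    \<open>n\<close> elements of \<open>B\<close>, it makes \<open>rest n B\<close> homogeneous for
    \<open>converges0 n\<close>.\<close>
  obtain B where B: "B \<subseteq> Q" "infinite B" and
    above: "\<And>s. finite s \<Longrightarrow> s \<subseteq> B \<Longrightarrow> homog (card s) {b \<in> B. \<forall>a\<in>s. a < b}"
  proof (rule fusion[OF Q, where P = "\<lambda>s Y. homog (card s) Y"])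
    show "homog (card s) Z" if "homog (card s) Y" "Z \<subseteq> Y" for s Y Z :: "nat set"
      using that unfolding homog_def by (meson subset_trans)
    show "\<exists>Z\<subseteq>Y. infinite Z \<and> homog (card s) Z" if "infinite Y" for s Y :: "nat set"
      using open_ramsey[OF that, of "converges0 (card s)"] open_converges0
      unfolding homog_def by metis
  qed blast
  have homog_rest: "homog n (rest n B)" for n
    using rest_eq_above[OF B(2), of n] above by metis
  define A where "A = {n. rest n B \<in> converges0 n}"
  \<comment> \<open>By homogeneity every infinite subset of \<open>rest n B\<close> gives the same
    verdict as \<open>rest n B\<close>.\<close>
  have A_iff: "n \<in> A \<longleftrightarrow> S \<in> converges0 n" if "S \<subseteq> rest n B" "infinite S" for n S
    using homog_rest[of n] that infinite_rest[OF B(2), of n] unfolding homog_def A_def by blast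
  have enum_A: "op_apply univ_op S = A" if S: "S \<subseteq> B" "infinite S" for S
  proof -
    have "n \<in> A \<longleftrightarrow> rest n S \<in> converges0 n" for n
      using rest_mono[OF S(1)] infinite_rest[OF S(2)] by (rule A_iff)
    then show ?thesis using enum[of S] S B(1) by auto
  qed
  have inf_A: "infinite A"
  proof -
    \<comment> \<open>The functional with constant value 0 converges to 0 at each of its names,
      whatever \<open>t\<close> is.\<close>
    have "range (\<lambda>t. prod_encode (to_nat Zero, t)) \<subseteq> A"
      by (auto simp: A_def mem_converges0 phi_const_zero)
    moreover have "infinite (range (\<lambda>t. prod_encode (to_nat Zero, t)))"
      by (subst finite_image_iff) (auto simp: inj_def)
    ultimately show ?thesis using finite_subset by blast
  qed
  have not_computed: "\<exists>D\<subseteq>C. infinite D \<and> \<not> turing_le A D" if C: "C \<subseteq> B" "infinite C" for C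
  proof -
    \<comment> \<open>\<open>D\<close> is so sparse in \<open>C\<close> that deleting its first \<open>e\<close> elements \<open>s\<close> leaves a subset of
      \<open>rest n B\<close> for the name \<open>n\<close> of \<open>(e, s)\<close>, where homogeneity applies.\<close>
    define far where "far s Y \<longleftrightarrow> Y \<subseteq> rest (prod_encode (card s, set_encode s)) C"
      for s Y :: "nat set"
    obtain D where D: "D \<subseteq> C" "infinite D" and
      far: "\<And>s. finite s \<Longrightarrow> s \<subseteq> D \<Longrightarrow> far s {b \<in> D. \<forall>a\<in>s. a < b}"
    proof (rule fusion[OF C(2), where P = far])
      show "far s Z" if "far s Y" "Z \<subseteq> Y" for s Y Z
        using that unfolding far_def by blast
      show "\<exists>Z\<subseteq>Y. infinite Z \<and> far s Z" if "Y \<subseteq> C" "infinite Y" for s Y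
        using rest_mono[OF that(1)] rest_subset infinite_rest[OF that(2)]
        by (intro exI[of _ "rest (prod_encode (card s, set_encode s)) Y"]) (simp add: far_def)
    qed blast
    have "\<not> turing_le A D"
    proof
      assume "turing_le A D"
      then obtain e where e: "\<And>n. phi e D n (of_bool (n \<in> A))"
        using turing_le_phi by blast
      from D(2) obtain s where s: "finite s" "s \<subseteq> D" "card s = e" "rest e D = {b \<in> D. \<forall>a\<in>s. a < b}"
          "s \<union> rest e D = D"
        by (rule rest_eq_above)
      define n where "n = prod_encode (e, set_encode s)"
      have "rest e D \<subseteq> rest n C"
        using far[OF s(1,2)] s(3,4) unfolding far_def n_def by simp
      then have "rest e D \<subseteq> rest n B"
        using rest_mono[OF C(1)] by blast
      then have "n \<in> A \<longleftrightarrow> rest e D \<in> converges0 n"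
        using infinite_rest[OF D(2)] by (rule A_iff)
      also have "\<dots> \<longleftrightarrow> phi e (s \<union> rest e D) n 0"
        using s(1) by (simp add: n_def mem_converges0)
      finally have "n \<in> A \<longleftrightarrow> phi e D n 0"
        unfolding s(5) .
      \<comment> \<open>At its own name \<open>n\<close> the functional outputs 0 iff
        \<open>n \<in> A\<close>, yet as a reduction it outputs 1 iff
        \<open>n \<in> A\<close>.\<close>
      then show False
        using e[of n] phi_unique by (cases "n \<in> A") fastforce+
    qed
    with D show ?thesis by blast
  qed
  from inf_A B(2) enum_A not_computed show thesis by (rule that)
qed

section \<open>Two enumerations without a common computable subset\<close>

text \<open>Tables all of whose entries have \<open>u = 0\<close>, i.e. which do not depend on the oracle.\<close>
definition enc :: "nat set \<Rightarrow> nat" where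
  "enc W = set_encode ((\<lambda>n. prod_encode (0, prod_encode (0, n))) ` W)"

definition content :: "nat \<Rightarrow> nat set" where
  "content w = {n. prod_encode (0, prod_encode (0, n)) \<in> set_decode w}"

lemma content_enc: "finite W \<Longrightarrow> content (enc W) = W"
  unfolding content_def enc_def by (subst set_encode_inverse) auto

lemma finite_content: "finite (content w)"
proof (rule inj_on_finite)
  show "inj_on (\<lambda>n. prod_encode (0, prod_encode (0, n))) (content w)"
    by (auto simp: inj_on_def)
  show "(\<lambda>n. prod_encode (0, prod_encode (0, n))) ` content w \<subseteq> set_decode w"
    by (auto simp: content_def)
qed simp

text \<open>Ensures that a table listing a large element is itself large, hence lies beyond the
  height of a condition.\<close>

lemma less_enc:
  assumes "finite W" "m \<in> W"
  shows "m < enc W"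
proof -
  let ?c = "prod_encode (0, prod_encode (0, m))"
  have "m \<le> ?c"
    using le_prod_encode_2 order_trans by blast
  also have "\<dots> < 2 ^ ?c" by (rule less_exp)
  also have "\<dots> \<le> enc W"
    unfolding enc_def set_encode_def using assms by (intro member_le_sum) auto
  finally show ?thesis .
qed

text \<open>An entry with \<open>u = 0\<close> and restriction code 0 fires for every oracle,
  because the empty restriction has code 0.\<close>

lemma op_apply_enc:
  assumes "\<And>w. w \<in> S \<Longrightarrow> w = enc (content w)"
  shows "op_apply univ_op S = (\<Union>w\<in>S. content w)"
proof -
  have "prod_encode (u, c) \<in> set_decode w \<longleftrightarrow>
      u = 0 \<and> (\<exists>n. c = prod_encode (0, n) \<and> n \<in> content w)" if "w \<in> S" for w u c
  proof -
    have "set_decode w = (\<lambda>n. prod_encode (0, prod_encode (0, n))) ` content w"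
      by (subst assms[OF that]) (simp add: enc_def finite_content)
    then show ?thesis by auto
  qed
  then show ?thesis
    unfolding op_apply_univ_op by fastforce
qed

text \<open>The two infinite sets under construction are indexed by \<open>bool\<close>. A condition fixes both of them
  below \<open>height\<close>, and the elements \<open>pos\<close> and non-elements \<open>neg\<close> of the set to be enumerated.\<close>
datatype cond = Cond (stem: "bool \<Rightarrow> nat set") (height: nat) (pos: "nat set") (neg: "nat set")

definition valid :: "cond \<Rightarrow> bool" where
  "valid p \<longleftrightarrow> finite (pos p) \<and> finite (neg p) \<and> pos p \<inter> neg p = {} \<and>
    (\<forall>i. stem p i \<subseteq> {..<height p}) \<and>
    (\<forall>i. \<forall>w\<in>stem p i. w = enc (content w) \<and> content w \<subseteq> pos p)"

text \<open>The promise about tables added later. Carrying all of \<open>pos p\<close> is what makes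
  every infinite set of them enumerate everything.\<close>

definition admits :: "cond \<Rightarrow> nat \<Rightarrow> bool" where
  "admits p w \<longleftrightarrow> w = enc (content w) \<and> pos p \<subseteq> content w \<and> content w \<inter> neg p = {}"

text \<open>The oracle sets, finite or infinite, still compatible with \<open>p\<close> in
  coordinate \<open>i\<close>.\<close>

definition above :: "cond \<Rightarrow> bool \<Rightarrow> nat set \<Rightarrow> bool" where
  "above p i X \<longleftrightarrow> X \<inter> {..<height p} = stem p i \<and> (\<forall>w\<in>X. height p \<le> w \<longrightarrow> admits p w)"

definition ext :: "cond \<Rightarrow> cond \<Rightarrow> bool" where
  "ext p q \<longleftrightarrow> height p \<le> height q \<and> pos p \<subseteq> pos q \<and> neg p \<subseteq> neg q \<and>
    (\<forall>i. above p i (stem q i))"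

lemma admits_mono: "pos p \<subseteq> pos q \<Longrightarrow> neg p \<subseteq> neg q \<Longrightarrow> admits q w \<Longrightarrow> admits p w"
  unfolding admits_def by blast

lemma above_ext:
  assumes "ext p q" "above q i X"
  shows "above p i X"
proof -
  have le: "height p \<le> height q" and stem: "above p i (stem q i)"
    using assms(1) by (auto simp: ext_def)
  have X: "X \<inter> {..<height q} = stem q i"
    using assms(2) by (simp add: above_def)
  have "X \<inter> {..<height p} = (X \<inter> {..<height q}) \<inter> {..<height p}"
    using le by auto
  then have "X \<inter> {..<height p} = stem p i"
    using stem X by (simp add: above_def)
  moreover have "admits p w" if "w \<in> X" "height p \<le> w" for w
  proof (cases "w < height q")
    case True
    then have "w \<in> stem q i" using that X by blast
    then show ?thesis using stem that by (simp add: above_def)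
  next
    case False
    then have "admits q w" using that assms(2) by (simp add: above_def)
    then show ?thesis using assms(1) by (auto simp: ext_def intro: admits_mono)
  qed
  ultimately show ?thesis by (simp add: above_def)
qed

lemma above_stem: "valid p \<Longrightarrow> above p i (stem p i)"
  unfolding valid_def above_def by fastforce

lemma ext_refl: "valid p \<Longrightarrow> ext p p"
  unfolding ext_def by (simp add: above_stem)

lemma ext_trans:
  assumes "ext p q" "ext q r"
  shows "ext p r"
proof -
  have "above p i (stem r i)" for i
    using assms by (intro above_ext[OF assms(1)]) (simp add: ext_def)
  then show ?thesis using assms by (auto simp: ext_def)
qed

text \<open>\<open>p\<close> forces that \<open>e\<^sub>1\<close> and \<open>e\<^sub>2\<close> do
  not compute a common infinite subset of the enumerated set from the two constructed sets.
  Quantifying over everything compatible with \<open>p\<close> makes this survive extension.\<close>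

definition met :: "nat \<Rightarrow> nat \<Rightarrow> cond \<Rightarrow> bool" where
  "met e\<^sub>1 e\<^sub>2 p \<longleftrightarrow> (\<forall>X A C. (\<forall>i. above p i (X i)) \<longrightarrow> A \<inter> neg p = {} \<longrightarrow> C \<subseteq> A \<longrightarrow> infinite C \<longrightarrow>
    \<not> ((\<forall>n. phi e\<^sub>1 (X True) n (of_bool (n \<in> C))) \<and> (\<forall>n. phi e\<^sub>2 (X False) n (of_bool (n \<in> C)))))"

lemma met_ext:
  assumes "met e\<^sub>1 e\<^sub>2 p" "ext p q"
  shows "met e\<^sub>1 e\<^sub>2 q"
  unfolding met_def
proof (intro allI impI)
  fix X A C assume "\<forall>i. above q i (X i)" "A \<inter> neg q = {}" "C \<subseteq> A" "infinite C"
  moreover have "neg p \<subseteq> neg q" using assms(2) by (simp add: ext_def)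
  ultimately have "\<forall>i. above p i (X i)" "A \<inter> neg p = {}" "C \<subseteq> A" "infinite C"
    using above_ext[OF assms(2)] by blast+
  with assms(1) show "\<not> ((\<forall>n. phi e\<^sub>1 (X True) n (of_bool (n \<in> C))) \<and> (\<forall>n. phi e\<^sub>2 (X False) n (of_bool (n \<in> C))))"
    unfolding met_def by metis
qed

text \<open>Keeps all sets infinite: a fresh \<open>m\<close> beyond the height enters
  \<open>pos\<close>, and the table of the enlarged \<open>pos\<close> enters both stems.\<close>

lemma grow:
  assumes "valid p"
  obtains q where "valid q" "ext p q" "\<exists>m\<in>pos q. height p \<le> m" "\<forall>i. \<exists>w\<in>stem q i. height p \<le> w"
proof -
  have fin: "finite (pos p)" "finite (neg p)" "pos p \<inter> neg p = {}"
    and stem: "\<And>i. stem p i \<subseteq> {..<height p}"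
      "\<And>i w. w \<in> stem p i \<Longrightarrow> w = enc (content w) \<and> content w \<subseteq> pos p"
    using assms by (simp_all add: valid_def)
  obtain m where "m \<notin> neg p \<union> {..<height p}"
    using fin(2) ex_new_if_finite[OF infinite_UNIV_nat] by (metis finite_Un finite_lessThan)
  then have m: "m \<notin> neg p" "height p \<le> m" by auto
  define W where "W = insert m (pos p)"
  define w where "w = enc W"
  have content: "content w = W"
    using fin(1) by (simp add: w_def W_def content_enc)
  have "m < w"
    unfolding w_def using fin(1) by (intro less_enc) (auto simp: W_def)
  have "admits p w"
    using content m(1) fin(3) by (auto simp: admits_def w_def W_def)
  define q where "q = Cond (\<lambda>i. insert w (stem p i)) (Suc w) W (neg p)"
  have w: "height p \<le> w" using \<open>m < w\<close> m(2) by simp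
  have "valid q"
    unfolding valid_def
  proof (intro conjI allI ballI)
    fix i x assume "x \<in> stem q i"
    then show "x = enc (content x)" "content x \<subseteq> pos q"
      using stem(2)[of x i] content by (auto simp: q_def w_def W_def)
  qed (use fin m stem(1) w in \<open>force simp: q_def W_def\<close>)+
  moreover have "above p i (insert w (stem p i))" for i
    using stem(1)[of i] w \<open>admits p w\<close> by (auto simp: above_def)
  then have "ext p q"
    using w by (auto simp: ext_def q_def W_def)
  moreover have "m \<in> pos q" "\<forall>i. w \<in> stem q i"
    by (simp_all add: q_def W_def)
  ultimately show thesis using that m(2) w by blast
qed

text \<open>If \<open>\<Phi>\<^sub>e\<^sub>1\<close> can be made to accept some \<open>n \<notin> pos p\<close>, then either \<open>\<Phi>\<^sub>e\<^sub>2\<close> can be made to disagree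
  at \<open>n\<close>, or \<open>\<Phi>\<^sub>e\<^sub>2\<close> can only accept \<open>n\<close> and it suffices to keep \<open>n\<close> out of the enumerated set.\<close>
lemma meet:
  assumes "valid p"
  obtains q where "valid q" "ext p q" "met e\<^sub>1 e\<^sub>2 q"
proof (cases "\<exists>n X. n \<notin> pos p \<and> above p True X \<and> phi e\<^sub>1 X n 1")
  case False
  \<comment> \<open>Here \<open>e\<^sub>1\<close> accepts only elements of the finite set
    \<open>pos p\<close>, so it computes no infinite \<open>C\<close>.\<close>
  have "met e\<^sub>1 e\<^sub>2 p"
    unfolding met_def
  proof (intro allI impI notI)
    fix X A C assume X: "\<forall>i. above p i (X i)" and "infinite C"
      and *: "(\<forall>n. phi e\<^sub>1 (X True) n (of_bool (n \<in> C))) \<and> (\<forall>n. phi e\<^sub>2 (X False) n (of_bool (n \<in> C)))"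
    have "C \<subseteq> pos p"
    proof
      fix n assume "n \<in> C"
      with * have "phi e\<^sub>1 (X True) n 1" by (metis of_bool_eq(2))
      with False X show "n \<in> pos p" by blast
    qed
    with \<open>infinite C\<close> assms show False
      unfolding valid_def by (meson finite_subset)
  qed
  with that assms ext_refl show thesis by blast
next
  case True
  then obtain n X1 where n: "n \<notin> pos p" "above p True X1" "phi e\<^sub>1 X1 n 1" by blast
  show thesis
  proof (cases "\<exists>X v. above p False X \<and> phi e\<^sub>2 X n v \<and> v \<noteq> 1")
    case False
    define q where "q = Cond (stem p) (height p) (pos p) (insert n (neg p))"
    have "valid q"
      using assms n(1) by (auto simp: valid_def q_def)
    moreover have "ext p q"
      using above_stem[OF assms] by (auto simp: ext_def q_def)
    moreover have "met e\<^sub>1 e\<^sub>2 q"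
      unfolding met_def
    proof (intro allI impI notI)
      fix X A C assume X: "\<forall>i. above q i (X i)" and A: "A \<inter> neg q = {}" "C \<subseteq> A"
        and *: "(\<forall>n. phi e\<^sub>1 (X True) n (of_bool (n \<in> C))) \<and> (\<forall>n. phi e\<^sub>2 (X False) n (of_bool (n \<in> C)))"
      have "above p False (X False)"
        using X above_ext[OF \<open>ext p q\<close>] by blast
      with False * have "of_bool (n \<in> C) = (1 :: nat)" by blast
      then have "n \<in> C" by (cases "n \<in> C") simp_all
      with A show False by (auto simp: q_def)
    qed
    ultimately show thesis by (rule that)
  next
    case True
    then obtain X2 v where X2: "above p False X2" "phi e\<^sub>2 X2 n v" "v \<noteq> 1" by blast
    from phi_use[OF n(3)] obtain u1 where
      u1: "\<And>u' Y. u1 \<le> u' \<Longrightarrow> Y \<inter> {..<u'} = X1 \<inter> {..<u'} \<Longrightarrow> phi e\<^sub>1 Y n 1" by blast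
    from phi_use[OF X2(2)] obtain u2 where
      u2: "\<And>u' Y. u2 \<le> u' \<Longrightarrow> Y \<inter> {..<u'} = X2 \<inter> {..<u'} \<Longrightarrow> phi e\<^sub>2 Y n v" by blast
    \<comment> \<open>Beyond both uses and the old height, so freezing \<open>X1\<close> and
      \<open>X2\<close> below \<open>u\<close> preserves the two conflicting computations.\<close>
    define u where "u = max (height p) (max u1 u2)"
    define X where "X i = (if i then X1 else X2)" for i
    have X: "above p i (X i)" for i
      using n(2) X2(1) by (simp add: X_def)
    \<comment> \<open>The tables now frozen into the stems enumerate their contents, so these must
      join \<open>pos\<close>.\<close>
    define F where "F = pos p \<union> (\<Union>i. \<Union>w\<in>X i \<inter> {..<u}. content w)"
    define q where "q = Cond (\<lambda>i. X i \<inter> {..<u}) u F (neg p)"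
    have elem: "w = enc (content w) \<and> content w \<inter> neg p = {}" if "w \<in> X i" for w i
    proof (cases "w < height p")
      case True
      then have "w \<in> stem p i" using that X[of i] by (auto simp: above_def)
      then show ?thesis using assms unfolding valid_def by blast
    next
      case False
      then show ?thesis using that X[of i] by (auto simp: above_def admits_def)
    qed
    have "finite F"
      using assms by (auto simp: F_def valid_def finite_content)
    moreover have "F \<inter> neg p = {}"
      using assms elem by (auto simp: F_def valid_def)
    ultimately have "valid q"
      using assms elem by (auto simp: valid_def q_def F_def)
    moreover have "above p i (X i \<inter> {..<u})" for i
    proof -
      have "X i \<inter> {..<u} \<inter> {..<height p} = X i \<inter> {..<height p}" by (auto simp: u_def)
      with X[of i] show ?thesis by (auto simp: above_def)
    qed
    then have "ext p q"
      by (auto simp: ext_def q_def F_def u_def)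
    moreover have "met e\<^sub>1 e\<^sub>2 q"
      unfolding met_def
    proof (intro allI impI notI)
      fix Y A C assume Y: "\<forall>i. above q i (Y i)"
        and *: "(\<forall>n. phi e\<^sub>1 (Y True) n (of_bool (n \<in> C))) \<and> (\<forall>n. phi e\<^sub>2 (Y False) n (of_bool (n \<in> C)))"
      have "Y i \<inter> {..<u} = X i \<inter> {..<u}" for i
        using Y by (simp add: above_def q_def)
      then have "phi e\<^sub>1 (Y True) n 1" "phi e\<^sub>2 (Y False) n v"
        using u1[of u "Y True"] u2[of u "Y False"] by (simp_all add: u_def X_def)
      with * have "of_bool (n \<in> C) = (1 :: nat)" "of_bool (n \<in> C) = v"
        using phi_unique by blast+
      with X2(3) show False by simp
    qed
    ultimately show thesis by (rule that)
  qed
qed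

text \<open>Stage \<open>k\<close> meets the requirement for the pair coded by \<open>k\<close> and
  then grows the condition. \<open>B\<close> is the union of the two limit sets, each of which is
  one of its infinite subsets.\<close>

lemma enumerated_no_computed_subset:
  obtains A B where "infinite A" "infinite B"
    "\<And>S. S \<subseteq> B \<Longrightarrow> infinite S \<Longrightarrow> op_apply univ_op S = A"
    "\<And>C. C \<subseteq> A \<Longrightarrow> infinite C \<Longrightarrow> \<exists>S\<subseteq>B. infinite S \<and> \<not> turing_le C S"
proof -
  define R where "R k p q \<longleftrightarrow> ext p q \<and> (case prod_decode k of (e\<^sub>1, e\<^sub>2) \<Rightarrow> met e\<^sub>1 e\<^sub>2 q) \<and>
    (\<exists>m\<in>pos q. height p \<le> m) \<and> (\<forall>i. \<exists>w\<in>stem q i. height p \<le> w)" for k p q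
  have "\<exists>f. \<forall>k. valid (f k) \<and> R k (f k) (f (Suc k))"
  proof (rule dependent_nat_choice)
    have "valid (Cond (\<lambda>_. {}) 0 {} {})" by (simp add: valid_def)
    then show "\<exists>p. valid p" ..
  next
    fix p k assume "valid p"
    obtain e1 e2 where k: "prod_decode k = (e1, e2)" by fastforce
    from \<open>valid p\<close> obtain q where q: "valid q" "ext p q" "met e1 e2 q"
      by (rule meet)
    from q(1) obtain r where r: "valid r" "ext q r" "\<exists>m\<in>pos r. height q \<le> m"
      "\<forall>i. \<exists>w\<in>stem r i. height q \<le> w"
      by (rule grow)
    have le: "height p \<le> height q" using q(2) by (simp add: ext_def)
    have "\<exists>m\<in>pos r. height p \<le> m" "\<exists>w\<in>stem r i. height p \<le> w" for i
      using r(3,4) le order_trans by blast+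
    then have "R k p r"
      using ext_trans[OF q(2) r(2)] met_ext[OF q(3) r(2)] by (simp add: R_def k)
    with r(1) show "\<exists>r. valid r \<and> R k p r" by blast
  qed
  then obtain f where f: "\<And>k. valid (f k)" "\<And>k. R k (f k) (f (Suc k))" by blast
  have ext: "ext (f j) (f k)" if "j \<le> k" for j k
    using that
  proof (induction rule: dec_induct)
    case (step k)
    then show ?case using f(2)[of k] ext_trans unfolding R_def by blast
  qed (rule ext_refl[OF f(1)])
  have height: "k \<le> height (f k)" for k
  proof (induction k)
    case (Suc k)
    obtain w where "w \<in> stem (f (Suc k)) True" "height (f k) \<le> w"
      using f(2)[of k] unfolding R_def by blast
    moreover have "stem (f (Suc k)) True \<subseteq> {..<height (f (Suc k))}"
      using f(1)[of "Suc k"] by (simp add: valid_def)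
    ultimately show ?case using Suc by auto
  qed simp
  define A where "A = (\<Union>k. pos (f k))"
  define S where "S i = (\<Union>k. stem (f k) i)" for i
  have stem_mono: "stem (f j) i \<subseteq> stem (f k) i" if "j \<le> k" for i j k
    using ext[OF that] unfolding ext_def above_def by blast
  have above: "above (f k) i (S i)" for k i
  proof -
    \<comment> \<open>An element from stage \<open>j\<close> is compared with \<open>f k\<close> at
      stage \<open>max j k\<close>, which extends both.\<close>
    have *: "w \<in> stem (f (max j k)) i \<and> above (f k) i (stem (f (max j k)) i)"
      if "w \<in> stem (f j) i" for w j
      using that stem_mono[of j "max j k" i] ext[of k "max j k"] by (auto simp: ext_def)
    have "stem (f k) i \<subseteq> {..<height (f k)}"
      using f(1)[of k] by (simp add: valid_def)
    with * show ?thesis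
      unfolding above_def S_def by fastforce
  qed
  have neg: "A \<inter> neg (f k) = {}" for k
  proof -
    have "pos (f j) \<inter> neg (f k) = {}" for j
      using ext[of j "max j k"] ext[of k "max j k"] f(1)[of "max j k"]
      unfolding ext_def valid_def by (meson disjoint_iff max.cobounded1 max.cobounded2 subsetD)
    then show ?thesis unfolding A_def by blast
  qed
  have unbounded: "infinite Z" if "\<And>k. \<exists>z\<in>Z. height (f k) \<le> z" for Z :: "nat set"
    using that height unfolding infinite_nat_iff_unbounded_le by (meson order_trans)
  have inf_A: "infinite A"
  proof (rule unbounded)
    fix k
    obtain m where "m \<in> pos (f (Suc k))" "height (f k) \<le> m"
      using f(2)[of k] unfolding R_def by blast
    then show "\<exists>m\<in>A. height (f k) \<le> m" unfolding A_def by blast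
  qed
  have inf_S: "infinite (S i)" for i
  proof (rule unbounded)
    fix k
    obtain w where "w \<in> stem (f (Suc k)) i" "height (f k) \<le> w"
      using f(2)[of k] unfolding R_def by blast
    then show "\<exists>w\<in>S i. height (f k) \<le> w" unfolding S_def by blast
  qed
  have elem: "w = enc (content w) \<and> content w \<subseteq> A" if w: "w \<in> S i" for w i
  proof -
    from w obtain k where "w \<in> stem (f k) i" unfolding S_def by blast
    then have "w = enc (content w) \<and> content w \<subseteq> pos (f k)"
      using f(1)[of k] by (simp add: valid_def)
    then show ?thesis unfolding A_def by blast
  qed
  have enum: "op_apply univ_op Z = A" if Z: "Z \<subseteq> S True \<union> S False" "infinite Z" for Z
  proof -
    have elem_Z: "w = enc (content w) \<and> content w \<subseteq> A" if "w \<in> Z" for w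
      using that Z(1) elem by blast
    then have "op_apply univ_op Z = (\<Union>w\<in>Z. content w)"
      by (intro op_apply_enc) simp
    also have "\<dots> = A"
    proof (intro equalityI subsetI)
      fix n assume "n \<in> (\<Union>w\<in>Z. content w)"
      with elem_Z show "n \<in> A" by blast
    next
      fix n assume "n \<in> A"
      then obtain k where k: "n \<in> pos (f k)" by (auto simp: A_def)
      from Z(2) obtain w where w: "w \<in> Z" "height (f k) \<le> w"
        by (meson infinite_nat_iff_unbounded_le)
      with Z(1) obtain i where "w \<in> S i" by blast
      with above[of k i] w(2) have "admits (f k) w"
        by (simp add: above_def)
      with k w(1) show "n \<in> (\<Union>w\<in>Z. content w)"
        unfolding admits_def by blast
    qed
    finally show ?thesis .
  qed
  have not_computed: "\<exists>Z\<subseteq>S True \<union> S False. infinite Z \<and> \<not> turing_le C Z"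
    if C: "C \<subseteq> A" "infinite C" for C
  proof -
    \<comment> \<open>Once this is shown, one of the two limit sets is the required infinite subset
      not computing \<open>C\<close>.\<close>
    have "\<not> (turing_le C (S True) \<and> turing_le C (S False))"
    proof
      assume "turing_le C (S True) \<and> turing_le C (S False)"
      then obtain e1 e2 where e: "\<And>n. phi e1 (S True) n (of_bool (n \<in> C))"
        "\<And>n. phi e2 (S False) n (of_bool (n \<in> C))"
        by (metis turing_le_phi)
      have met: "met e1 e2 (f (Suc (prod_encode (e1, e2))))"
        using f(2)[of "prod_encode (e1, e2)"] by (simp add: R_def)
      from met[unfolded met_def, rule_format, OF above neg C] e show False by simp
    qed
    then show ?thesis using inf_S by blast
  qed
  have "infinite (S True \<union> S False)"
    using inf_S by simp
  from inf_A this enum not_computed show thesis by (rule that)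
qed

section \<open>Both parts, with \<open>univ_op\<close> as the common operator\<close>

theorem theorem1p3:
  shows "(\<exists>A B \<Theta>. infinite A \<and> infinite B \<and> ce_operator \<Theta> \<and>
            (\<forall>S. S \<subseteq> B \<and> infinite S \<longrightarrow> op_apply \<Theta> S = A) \<and>
            \<not> (\<exists>C. C \<subseteq> B \<and> infinite C \<and>
                  (\<forall>D. D \<subseteq> C \<and> infinite D \<longrightarrow> turing_le A D)))
       \<and> (\<exists>A B \<Theta>. infinite A \<and> infinite B \<and> ce_operator \<Theta> \<and>
            (\<forall>S. S \<subseteq> B \<and> infinite S \<longrightarrow> op_apply \<Theta> S = A) \<and>
            \<not> (\<exists>C. C \<subseteq> A \<and> infinite C \<and>
                  (\<forall>S. S \<subseteq> B \<and> infinite S \<longrightarrow> turing_le C S)))"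
proof (rule conjI, goal_cases)
  case 1
  obtain A B where "infinite A" "infinite B"
    "\<And>S. S \<subseteq> B \<Longrightarrow> infinite S \<Longrightarrow> op_apply univ_op S = A"
    "\<And>C. C \<subseteq> B \<Longrightarrow> infinite C \<Longrightarrow> \<exists>D\<subseteq>C. infinite D \<and> \<not> turing_le A D"
    using enumerated_not_computed by blast
  then show ?case
    by - (rule exI[of _ A], rule exI[of _ B], rule exI[of _ univ_op],
      auto simp: ce_operator_univ_op)
next
  case 2
  obtain A B where "infinite A" "infinite B"
    "\<And>S. S \<subseteq> B \<Longrightarrow> infinite S \<Longrightarrow> op_apply univ_op S = A"
    "\<And>C. C \<subseteq> A \<Longrightarrow> infinite C \<Longrightarrow> \<exists>S\<subseteq>B. infinite S \<and> \<not> turing_le C S"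
    using enumerated_no_computed_subset by blast
  then show ?case
    by - (rule exI[of _ A], rule exI[of _ B], rule exI[of _ univ_op],
      auto simp: ce_operator_univ_op)
qed

end
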